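(* Let $\Phi:(0,\infty)\to\mathbb C$ be measurable, let $c\in(-1,0)$, assume $D_0:=\int_0^\infty\Phi(y)y^{-1}dy$ is finite and nonzero and $\int_0^\infty|\Phi(y)|y^{-c-1}dy<\infty$. Let $F(s)=\int_0^\infty y^{s-1}\Phi(y)dy$ where absolutely convergent, $\mathcal K(s)=-\frac{\pi}{2}\frac{\Gamma(s+1)}{\sin(\pi s/2)}$, $\Xi(z)=z\int_0^\infty\frac{e^{-zt}}{1+t^2}dt$, $S(\mu)=\frac1{D_0}\int_0^\infty\frac{\Phi(y)}{y}\Xi(\mu y)dy$, and fix $\mu>0$. Define $I(s;\mu)=\frac{1}{D_0}\mathcal K(s)F(-s)\mu^{-s}$. Let $a<c<b$ and assume: (1) $I(s;\mu)$ admits a meromorphic continuation to the strip $a<\Re s<b$; (2) for every $\sigma\in(a,b)$ such that the line $\Re s=\sigma$ contains no pole of $I$, $A(\sigma):=\int_{-\infty}^\infty\big|\frac1{D_0}\mathcal K(\sigma+it)F(-\sigma-it)\big|dt<\infty$; (3) for all $\sigma_1<\sigma_2$ with $[\sigma_1,\sigma_2]\subset(a,b)$, $\int_{\sigma_1}^{\sigma_2}|I(\sigma+iT;\mu)|d\sigma\to0$ and $\int_{\sigma_1}^{\sigma_2}|I(\sigma-iT;\mu)|d\sigma\to0$ as $T\to\infty$ (along $T$ for which the horizontal lines $\Im s=\pm T$ contain no pole). Then for any $a<\sigma_-<c<\sigma_+<b$ such that the lines $\Re s=\sigma_\pm$ contain no poles, $$S(\mu)=\sum_{\sigma_-<\Re\rho<c}\operatorname{Res}_{s=\rho}I(s;\mu)+\frac1{2\pi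 i}\int_{(\sigma_-)}I(s;\mu)\,ds,$$ $$S(\mu)=-\sum_{c<\Re\rho<\sigma_+}\operatorname{Res}_{s=\rho}I(s;\mu)+\frac1{2\pi i}\int_{(\sigma_+)}I(s;\mu)\,ds,$$ where each residue sum is understood as $\lim_{T\to\infty}$ of the sum over poles $\rho$ in the indicated vertical strip with $|\Im\rho|<T$. Moreover, for every pole-free $\sigma\in(a,b)$, $$\Big|\frac1{2\pi i}\int_{(\sigma)}I(s;\mu)\,ds\Big|\le\frac{\mu^{-\sigma}}{2\pi}A(\sigma).$$ Finally, if $\mathcal K(s)F(-s)=\sum_{j=1}^m a_{-j}(s-\rho)^{-j}+O(1)$ as $s\to\rho$ (a pole of order $m$), then $$\operatorname{Res}_{s=\rho}I(s;\mu)=\mu^{-\rho}P_{\rho,m-1}(\log\mu),\qquad P_{\rho,m-1}(L)=\frac1{D_0}\sum_{j=1}^m a_{-j}\frac{(-L)^{j-1}}{(j-1)!}.$$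
   Context: $\int_{(\sigma)}$ denotes integration upward along the vertical line $\Re s=\sigma$. *)

theory Defs
  imports "HOL-Complex_Analysis.Complex_Analysis" "HOL-Library.Landau_Symbols"
begin

definition mellin_abs_conv :: "(real \<Rightarrow> complex) \<Rightarrow> complex \<Rightarrow> bool" where
  "mellin_abs_conv Phi s \<longleftrightarrow>
     set_integrable lebesgue {0<..} (\<lambda>y. (of_real y :: complex) powr (s - 1) * Phi y)"

definition mellinF :: "(real \<Rightarrow> complex) \<Rightarrow> complex \<Rightarrow> complex" where
  "mellinF Phi s = set_lebesgue_integral lebesgue {0<..} (\<lambda>y. (of_real y :: complex) powr (s - 1) * Phi y)"

definition D0 :: "(real \<Rightarrow> complex) \<Rightarrow> complex" where
  "D0 Phi = set_lebesgue_integral lebesgue {0<..} (\<lambda>y. Phi y / of_real y)"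

definition Kfun :: "complex \<Rightarrow> complex" where
  "Kfun s = - (of_real pi / 2) * Gamma (s + 1) / sin (of_real pi * s / 2)"

definition Xi :: "real \<Rightarrow> real" where
  "Xi z = z * set_lebesgue_integral lborel {0<..} (\<lambda>t. exp (- z * t) / (1 + t\<^sup>2))"

definition Sfun :: "(real \<Rightarrow> complex) \<Rightarrow> real \<Rightarrow> complex" where
  "Sfun Phi \<mu> = (1 / D0 Phi) *
     set_lebesgue_integral lebesgue {0<..} (\<lambda>y. Phi y / of_real y * of_real (Xi (\<mu> * y)))"

text \<open>I(s;mu) on its natural domain (where the Mellin integral F(-s) converges absolutely).\<close>
definition Ifun :: "(real \<Rightarrow> complex) \<Rightarrow> real \<Rightarrow> complex \<Rightarrow> complex" where
  "Ifun Phi \<mu> s = (1 / D0 Phi) * Kfun s * mellinF Phi (- s) * (of_real \<mu> :: complex) powr (- s)"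

definition strip :: "real \<Rightarrow> real \<Rightarrow> complex set" where
  "strip a b = {s. a < Re s \<and> Re s < b}"

definition poles :: "(complex \<Rightarrow> complex) \<Rightarrow> real \<Rightarrow> real \<Rightarrow> complex set" where
  "poles f a b = {\<rho> \<in> strip a b. is_pole f \<rho>}"

definition vline_integral :: "(complex \<Rightarrow> complex) \<Rightarrow> real \<Rightarrow> complex" where
  "vline_integral f \<sigma> = \<i> * integral\<^sup>L lborel (\<lambda>t. f (Complex \<sigma> t))"

text \<open>A(sigma) = int |(1/D0) K(sigma+it) F(-sigma-it)| dt, with (1/D0) K F continued as Ic(s) mu^s.\<close>
definition Afun :: "(complex \<Rightarrow> complex) \<Rightarrow> real \<Rightarrow> real \<Rightarrow> real" where
  "Afun Ic \<mu> \<sigma> = integral\<^sup>L lborel (\<lambda>t. cmod (Ic (Complex \<sigma> t) * (of_real \<mu> :: complex) powr (Complex \<sigma> t)))"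

end

theory Submission
  imports Defs
begin

text \<open>
  The transform \<open>Xi\<close> is the inverse Mellin transform of \<open>Kfun\<close> on every line \<open>-1 < Re s < 0\<close>.  Inserting
  this into \<open>Sfun\<close> and exchanging the absolutely convergent integrals gives
  \<open>Sfun Phi \<mu> = vline_integral Ic c / (2 \<pi> \<i>)\<close>.  On the line \<open>Re s = c\<close> the integrand is bounded, so
  the line carries no pole, and moving it to \<open>\<sigma>m\<close> or \<open>\<sigma>p\<close> by the residue theorem on growing
  rectangles yields the two expansions.  The inversion formula for \<open>Xi\<close> is itself obtained by
  such a shift, applied to the cosecant factor of \<open>Kfun\<close>.
\<close>

section \<open>Shifting vertical lines of integration\<close>

text \<open>The shape of \<open>Kfun\<close> dictates the route: 1/(1+u^2) is a line integral of
  \<open>csc_kernel s\<close> times u^s, and integrating u^s exp(-z u) over u > 0 gives Gamma(s+1)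
  z^(-s-1), so \<open>Xi\<close> acquires the product of both factors. Convergence at u = 0 asks for
  Re s > -1 and the cosecant pole at 0 for Re s < 0, whence the range of \<open>c\<close>. Two gaps
  separate the hypotheses from the residue theorem. Horizontal integrals are controlled only along
  heights that carry no pole, while the residue sums are to converge along all heights. And
  \<open>Ic\<close> is known to equal \<open>Ifun\<close> only where the Mellin integral converges
  absolutely, which need not include a neighbourhood of the line Re s = c; this is why the absence
  of poles there is argued through boundedness.\<close>

lemma contour_integral_linepath_same_Im:
  assumes "a < b"
  shows "contour_integral (linepath (Complex a c) (Complex b c)) f =
           integral {a..b} (\<lambda>x. f (Complex x c))"
proof -
  have "contour_integral (linepath (Complex a c) (Complex b c)) f =
         (Complex b c - Complex a c) * integral {0..1} (\<lambda>x. f (linepath (Complex a c) (Complex b c) x))"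
    by (simp add: contour_integral_integral)
  also have "Complex b c - Complex a c = of_real (b - a)"
    by (simp add: Complex_eq algebra_simps)
  also have "integral {0..1} (\<lambda>x. f (linepath (Complex a c) (Complex b c) x)) =
             integral {0..1} (\<lambda>x. f (Complex (linepath a b x) c))"
    by (simp add: linepath_def Complex_eq scaleR_conv_of_real algebra_simps)
  also have "\<dots> = integral {0..(b - a) / (b - a)} (\<lambda>x. f (Complex (a + (b - a) * x) c))"
    using \<open>a < b\<close> by (simp add: algebra_simps linepath_def)
  also have "{0..(b - a) / (b - a)} = (\<lambda>x. x / (b - a)) ` {0..b - a}"
    using \<open>a < b\<close> by simp
  also have "integral \<dots> (\<lambda>x. f (Complex (a + (b - a) * x) c)) =
             integral {a-a..b-a} (\<lambda>x. f (Complex (x + a) c)) / of_real (b - a)"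
    using \<open>a < b\<close> by (subst integral_stretch_real) (auto simp: scaleR_conv_of_real add_ac)
  also have "\<dots> = integral {a..b} (\<lambda>x. f (Complex x c)) / of_real (b - a)"
    by (subst integral_shift_real_ivl) (rule refl)
  finally show ?thesis
    using \<open>a < b\<close> by simp
qed

section \<open>Residue sums over rectangles\<close>

lemma open_strip: "open (strip a b)"
proof -
  have "strip a b = {s. a < Re s} \<inter> {s. Re s < b}"
    by (auto simp: strip_def)
  thus ?thesis
    by (simp add: open_halfspace_Re_gt open_halfspace_Re_lt open_Int)
qed

lemma cbox_subset_strip: "a < Re p \<Longrightarrow> Re q < b \<Longrightarrow> cbox p q \<subseteq> strip a b"
  by (auto simp: strip_def in_cbox_complex_iff)

lemma poles_sparse:
  assumes "f meromorphic_on strip a b"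
  shows "poles f a b sparse_in strip a b"
  by (rule sparse_in_subset2[OF meromorphic_on_imp_sparse_singularities'[OF assms]])
     (auto simp: poles_def dest: analytic_at_imp_no_pole)

text \<open>The boundary is traversed anticlockwise, hence right side minus left side and bottom
  minus top. Nice meromorphy makes \<open>f\<close> analytic at every point that is not a pole, so
  all four boundary integrals exist.\<close>

lemma rectangle_residues:
  assumes f: "f nicely_meromorphic_on strip a b"
    and \<sigma>: "a < \<sigma>1" "\<sigma>1 < \<sigma>2" "\<sigma>2 < b" and T: "T > 0"
    and lines: "\<forall>\<rho>\<in>poles f a b. Re \<rho> \<noteq> \<sigma>1 \<and> Re \<rho> \<noteq> \<sigma>2 \<and> \<bar>Im \<rho>\<bar> \<noteq> T"
  shows "2 * of_real pi * \<i> *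
      (\<Sum>\<rho>\<in>{\<rho>\<in>poles f a b. \<sigma>1 < Re \<rho> \<and> Re \<rho> < \<sigma>2 \<and> \<bar>Im \<rho>\<bar> < T}. residue f \<rho>) =
      (\<i> * integral {-T..T} (\<lambda>t. f (Complex \<sigma>2 t)) - \<i> * integral {-T..T} (\<lambda>t. f (Complex \<sigma>1 t)))
      + (integral {\<sigma>1..\<sigma>2} (\<lambda>x. f (Complex x (-T))) - integral {\<sigma>1..\<sigma>2} (\<lambda>x. f (Complex x T)))"
    (is "_ * sum _ ?P = ?rhs")
proof -
  \<comment> \<open>The residue theorem wants an open set around the closed rectangle with finitely
    many poles. A slightly larger box serves: its closure is compact and still inside the strip,
    where poles are sparse.\<close>
  obtain a' b' where ab: "a < a'" "a' < \<sigma>1" "\<sigma>2 < b'" "b' < b"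
    using dense \<sigma> by meson
  define S where "S = box (Complex a' (-T-1)) (Complex b' (T+1))"
  define pts where "pts = S \<inter> poles f a b"
  have mero: "f meromorphic_on strip a b"
    using f by (simp add: nicely_meromorphic_on_def)
  have Sc: "S \<subseteq> cbox (Complex a' (-T-1)) (Complex b' (T+1))"
    by (auto simp: S_def box_subset_cbox)
  have sub: "cbox (Complex a' (-T-1)) (Complex b' (T+1)) \<subseteq> strip a b"
    by (rule cbox_subset_strip) (use ab in auto)
  have "finite (cbox (Complex a' (-T-1)) (Complex b' (T+1)) \<inter> poles f a b)"
    by (rule sparse_in_compact_finite[OF sparse_in_subset[OF poles_sparse[OF mero] sub]]) simp
  hence fin: "finite pts"
    by (rule finite_subset[rotated]) (use Sc in \<open>auto simp: pts_def\<close>)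
  have ana: "f analytic_on {z}" if "z \<in> strip a b" "z \<notin> poles f a b" for z
    using that f by (intro nicely_meromorphic_on_imp_analytic_at) (auto simp: poles_def)
  have holo: "f holomorphic_on S - pts"
    by (rule analytic_imp_holomorphic, subst analytic_on_analytic_at)
       (use Sc sub ana in \<open>auto simp: pts_def\<close>)
  let ?g = "rectpath (Complex \<sigma>1 (-T)) (Complex \<sigma>2 T)"
  have im: "path_image ?g \<subseteq> S - pts"
    using \<sigma> T ab lines by (auto simp: path_image_rectpath S_def pts_def in_box_complex_iff)
  have "contour_integral ?g f = 2 * pi * \<i> * (\<Sum>p\<in>pts. winding_number ?g p * residue f p)"
  proof (rule Residue_theorem)
    show "open S" "connected S"
      by (simp_all add: S_def convex_connected open_box)
    show "\<forall>z. z \<notin> S \<longrightarrow> winding_number ?g z = 0"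
    proof (intro allI impI winding_number_rectpath_outside)
      fix z assume "z \<notin> S"
      thus "z \<notin> cbox (Complex \<sigma>1 (-T)) (Complex \<sigma>2 T)"
        using \<sigma> T ab by (auto simp: S_def in_box_complex_iff in_cbox_complex_iff)
    qed (use \<sigma> T in auto)
  qed (use fin holo im in auto)
  \<comment> \<open>A pole has winding number 1 inside the rectangle and 0 outside; by
    \<open>lines\<close> none lies on the boundary.\<close>
  also have "(\<Sum>p\<in>pts. winding_number ?g p * residue f p) = (\<Sum>\<rho>\<in>?P. residue f \<rho>)"
  proof (rule sum.mono_neutral_cong_right)
    show "?P \<subseteq> pts"
      using \<sigma> T ab by (auto simp: pts_def S_def in_box_complex_iff)
    show "\<forall>p\<in>pts - ?P. winding_number ?g p * residue f p = 0"
    proof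
      fix p assume p: "p \<in> pts - ?P"
      have "p \<notin> cbox (Complex \<sigma>1 (-T)) (Complex \<sigma>2 T)"
      proof
        assume "p \<in> cbox (Complex \<sigma>1 (-T)) (Complex \<sigma>2 T)"
        hence "\<sigma>1 \<le> Re p" "Re p \<le> \<sigma>2" "\<bar>Im p\<bar> \<le> T"
          by (auto simp: in_cbox_complex_iff)
        moreover have "p \<in> poles f a b" using p by (simp add: pts_def)
        ultimately show False using p lines by fastforce
      qed
      thus "winding_number ?g p * residue f p = 0"
        using \<sigma> T by (subst winding_number_rectpath_outside) auto
    qed
    show "winding_number ?g p * residue f p = residue f p" if "p \<in> ?P" for p
      using that \<sigma> T by (subst winding_number_rectpath) (auto simp: in_box_complex_iff)
  qed fact
  also have "contour_integral ?g f =
      contour_integral (linepath (Complex \<sigma>1 (-T)) (Complex \<sigma>2 (-T))) f +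
      contour_integral (linepath (Complex \<sigma>2 (-T)) (Complex \<sigma>2 T)) f -
      contour_integral (linepath (Complex \<sigma>1 T) (Complex \<sigma>2 T)) f -
      contour_integral (linepath (Complex \<sigma>1 (-T)) (Complex \<sigma>1 T)) f"
  proof -
    have int: "f contour_integrable_on linepath p q" if "closed_segment p q \<subseteq> path_image ?g" for p q
      by (rule contour_integrable_continuous_linepath, rule continuous_on_subset[OF _ that],
          rule continuous_on_subset[OF holomorphic_on_imp_continuous_on[OF holo] im])
    note cs = closed_segment_same_Re closed_segment_same_Im closed_segment_eq_real_ivl path_image_rectpath
    have i1: "f contour_integrable_on linepath (Complex \<sigma>1 (-T)) (Complex \<sigma>2 (-T))"
      by (rule int) (use \<sigma> T in \<open>auto simp: cs\<close>)
    have i2: "f contour_integrable_on linepath (Complex \<sigma>2 (-T)) (Complex \<sigma>2 T)"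
      by (rule int) (use \<sigma> T in \<open>auto simp: cs\<close>)
    have i3: "f contour_integrable_on linepath (Complex \<sigma>2 T) (Complex \<sigma>1 T)"
      by (rule int) (use \<sigma> T in \<open>auto simp: cs\<close>)
    have i4: "f contour_integrable_on linepath (Complex \<sigma>1 T) (Complex \<sigma>1 (-T))"
      by (rule int) (use \<sigma> T in \<open>auto simp: cs\<close>)
    have r3: "contour_integral (linepath (Complex \<sigma>2 T) (Complex \<sigma>1 T)) f =
        - contour_integral (linepath (Complex \<sigma>1 T) (Complex \<sigma>2 T)) f"
      using contour_integral_reversepath[of "linepath (Complex \<sigma>1 T) (Complex \<sigma>2 T)" f]
      by simp
    have r4: "contour_integral (linepath (Complex \<sigma>1 T) (Complex \<sigma>1 (-T))) f =
        - contour_integral (linepath (Complex \<sigma>1 (-T)) (Complex \<sigma>1 T)) f"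
      using contour_integral_reversepath[of "linepath (Complex \<sigma>1 (-T)) (Complex \<sigma>1 T)" f]
      by simp
    show ?thesis
      using i1 i2 i3 i4 unfolding rectpath_def Let_def
      by (simp add: r3 r4 contour_integrable_joinI valid_path_join)
  qed
  also have "\<dots> = ?rhs"
    using \<sigma> T
    by (simp add: contour_integral_linepath_same_Im
          contour_integral_linepath_same_Re[of "Complex \<sigma>2 (-T)" \<sigma>2 "Complex \<sigma>2 T" "-T" T]
          contour_integral_linepath_same_Re[of "Complex \<sigma>1 (-T)" \<sigma>1 "Complex \<sigma>1 T" "-T" T])
  finally show ?thesis by (simp add: mult_ac)
qed

section \<open>Letting the height of the rectangles tend to infinity\<close>

lemma tendsto_integral_symmetric_interval:
  fixes h :: "real \<Rightarrow> 'a :: euclidean_space"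
  assumes "integrable lborel h"
  shows "((\<lambda>T. integral {-T..T} h) \<longlongrightarrow> integral\<^sup>L lborel h) at_top"
proof -
  have eq: "integral {-T..T} h = (\<integral>x. indicator {-T..T} x *\<^sub>R h x \<partial>lborel)" for T
    using set_borel_integral_eq_integral(2)[of "{-T..T}" h]
      integrable_mult_indicator[OF _ assms, of "{-T..T}"]
    by (simp add: set_integrable_def set_lebesgue_integral_def)
  have [measurable]: "h \<in> borel_measurable lborel"
    using assms by auto
  show ?thesis
    unfolding eq
  proof (rule integral_dominated_convergence_at_top[where w = "\<lambda>x. norm (h x)"])
    show "AE x in lborel. ((\<lambda>T. indicator {-T..T} x *\<^sub>R h x) \<longlongrightarrow> h x) at_top"
    proof
      fix x :: real
      have "eventually (\<lambda>T. indicator {-T..T} x *\<^sub>R h x = h x) at_top"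
        using eventually_ge_at_top[of "\<bar>x\<bar>"] by eventually_elim (auto simp: indicator_def)
      thus "((\<lambda>T. indicator {-T..T} x *\<^sub>R h x) \<longlongrightarrow> h x) at_top"
        by (rule tendsto_eventually)
    qed
  qed (use assms in \<open>auto split: split_indicator\<close>)
qed

lemma countable_poles:
  assumes "f meromorphic_on strip a b"
  shows "countable (poles f a b)"
proof -
  have "countable (strip a b \<inter> poles f a b)"
    by (intro sparse_imp_countable open_strip poles_sparse assms)
  moreover have "strip a b \<inter> poles f a b = poles f a b"
    by (auto simp: poles_def)
  ultimately show ?thesis by simp
qed

lemma finite_poles_rectangle:
  assumes "f meromorphic_on strip a b" "a < \<sigma>1" "\<sigma>2 < b"
  shows "finite {\<rho>\<in>poles f a b. \<sigma>1 < Re \<rho> \<and> Re \<rho> < \<sigma>2 \<and> \<bar>Im \<rho>\<bar> < T}"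
proof -
  let ?C = "cbox (Complex \<sigma>1 (-T)) (Complex \<sigma>2 T)"
  have "?C \<subseteq> strip a b"
    by (rule cbox_subset_strip) (use assms in auto)
  hence "finite (?C \<inter> poles f a b)"
    by (intro sparse_in_compact_finite sparse_in_subset[OF poles_sparse[OF assms(1)]]) simp_all
  thus ?thesis
    by (rule finite_subset[rotated]) (auto simp: in_cbox_complex_iff)
qed

text \<open>Along this filter the horizontal integrals are assumed to vanish. The absolute value
  keeps poles off the upper and the lower side at once. Being expanded on parsing, the abbreviation
  agrees literally with the filter written out in \<open>theorem2\<close>.\<close>

abbreviation (input) pole_free_heights :: "(complex \<Rightarrow> complex) \<Rightarrow> real \<Rightarrow> real \<Rightarrow> real filter" where
  "pole_free_heights f a b \<equiv> inf at_top (principal {T. \<forall>\<rho>\<in>poles f a b. \<bar>Im \<rho>\<bar> \<noteq> T})"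

text \<open>As a function of \<open>T\<close> the sum is constant on a left neighbourhood of every point, because
  only finitely many poles of the substrip lie below a given height; and the forbidden heights are
  countable.\<close>

lemma tendsto_pole_free_heights_imp_at_top:
  fixes f :: "complex \<Rightarrow> complex" and r :: "complex \<Rightarrow> 'a :: real_normed_vector"
  assumes f: "f meromorphic_on strip a b" "a < \<sigma>1" "\<sigma>2 < b"
  defines "P \<equiv> \<lambda>T. {\<rho>\<in>poles f a b. \<sigma>1 < Re \<rho> \<and> Re \<rho> < \<sigma>2 \<and> \<bar>Im \<rho>\<bar> < T}"
  assumes lim: "((\<lambda>T. \<Sum>\<rho>\<in>P T. r \<rho>) \<longlongrightarrow> L) (pole_free_heights f a b)"
  shows "((\<lambda>T. \<Sum>\<rho>\<in>P T. r \<rho>) \<longlongrightarrow> L) at_top"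
proof (rule tendstoI)
  fix e :: real assume e: "e > 0"
  have "eventually (\<lambda>T. (\<forall>\<rho>\<in>poles f a b. \<bar>Im \<rho>\<bar> \<noteq> T) \<longrightarrow> dist (\<Sum>\<rho>\<in>P T. r \<rho>) L < e) at_top"
    using tendstoD[OF lim e] by (simp add: eventually_inf_principal)
  then obtain N where N: "\<And>T. T \<ge> N \<Longrightarrow> \<forall>\<rho>\<in>poles f a b. \<bar>Im \<rho>\<bar> \<noteq> T \<Longrightarrow> dist (\<Sum>\<rho>\<in>P T. r \<rho>) L < e"
    by (auto simp: eventually_at_top_linorder)
  show "eventually (\<lambda>T. dist (\<Sum>\<rho>\<in>P T. r \<rho>) L < e) at_top"
    using eventually_gt_at_top[of N]
  proof eventually_elim
    case (elim T)
    \<comment> \<open>Every height strictly between \<open>M\<close> and \<open>T\<close> counts the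
      same poles as \<open>T\<close>. Inserting \<open>N\<close> makes the maximum exist for empty
      \<open>P T\<close> and keeps these heights in the range where the limit estimate
      applies.\<close>
    define M where "M = Max (insert N ((\<lambda>\<rho>. \<bar>Im \<rho>\<bar>) ` P T))"
    have fin: "finite (P T)"
      unfolding P_def by (rule finite_poles_rectangle[OF f])
    have M: "M < T" "N \<le> M" "\<And>\<rho>. \<rho> \<in> P T \<Longrightarrow> \<bar>Im \<rho>\<bar> \<le> M"
      using fin elim by (auto simp: M_def) (auto simp: P_def)
    have "countable ((\<lambda>\<rho>. \<bar>Im \<rho>\<bar>) ` poles f a b)"
      by (intro countable_image countable_poles f)
    moreover have "uncountable {M<..<T}"
      using M by (simp add: uncountable_open_interval)
    ultimately obtain T' where T': "T' \<in> {M<..<T} - (\<lambda>\<rho>. \<bar>Im \<rho>\<bar>) ` poles f a b"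
      by (metis Diff_eq_empty_iff countable_subset ex_in_conv)
    have "P T' \<subseteq> P T"
      using T' by (auto simp: P_def)
    moreover have "P T \<subseteq> P T'"
    proof
      fix \<rho> assume \<rho>: "\<rho> \<in> P T"
      with M(3)[OF this] T' show "\<rho> \<in> P T'"
        by (simp add: P_def)
    qed
    ultimately have "P T' = P T" by blast
    moreover have "dist (\<Sum>\<rho>\<in>P T'. r \<rho>) L < e"
      by (rule N) (use T' M in auto)
    ultimately show ?case by simp
  qed
qed

lemma pole_free_heights_le_at_top: "pole_free_heights f a b \<le> at_top"
  by simp

text \<open>Heights first go to infinity through pole-free values only, because both the rectangle
  formula and the decay of the horizontal sides are tied to them; the limit along all heights is
  recovered at the end.\<close>

lemma vertical_shift_nice:
  assumes f: "f nicely_meromorphic_on strip a b"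
    and \<sigma>: "a < \<sigma>1" "\<sigma>1 < \<sigma>2" "\<sigma>2 < b"
    and lines: "\<forall>\<rho>\<in>poles f a b. Re \<rho> \<noteq> \<sigma>1 \<and> Re \<rho> \<noteq> \<sigma>2"
    and int: "integrable lborel (\<lambda>t. f (Complex \<sigma>1 t))" "integrable lborel (\<lambda>t. f (Complex \<sigma>2 t))"
    and up: "((\<lambda>T. LBINT x:{\<sigma>1..\<sigma>2}. cmod (f (Complex x T))) \<longlongrightarrow> 0) (pole_free_heights f a b)"
    and down: "((\<lambda>T. LBINT x:{\<sigma>1..\<sigma>2}. cmod (f (Complex x (-T)))) \<longlongrightarrow> 0) (pole_free_heights f a b)"
  shows "((\<lambda>T. \<Sum>\<rho>\<in>{\<rho>\<in>poles f a b. \<sigma>1 < Re \<rho> \<and> Re \<rho> < \<sigma>2 \<and> \<bar>Im \<rho>\<bar> < T}. residue f \<rho>)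
           \<longlongrightarrow> (vline_integral f \<sigma>2 - vline_integral f \<sigma>1) / (2 * of_real pi * \<i>)) at_top"
proof -
  have mero: "f meromorphic_on strip a b"
    using f by (simp add: nicely_meromorphic_on_def)
  let ?F = "pole_free_heights f a b"
  let ?P = "\<lambda>T. {\<rho>\<in>poles f a b. \<sigma>1 < Re \<rho> \<and> Re \<rho> < \<sigma>2 \<and> \<bar>Im \<rho>\<bar> < T}"
  let ?H = "\<lambda>T. integral {\<sigma>1..\<sigma>2} (\<lambda>x. f (Complex x T))"
  \<comment> \<open>On a pole-free height \<open>f\<close> is continuous along the segment, so its
    integral exists and is dominated by the integral of the norm that \<open>up\<close> and
    \<open>down\<close> send to 0.\<close>
  have bound: "norm (?H T') \<le> (LBINT x:{\<sigma>1..\<sigma>2}. cmod (f (Complex x T')))"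
    if "\<forall>\<rho>\<in>poles f a b. \<bar>Im \<rho>\<bar> \<noteq> T" "\<bar>T'\<bar> = T" for T T'
  proof -
    have ana: "isCont f (Complex x T')" if "x \<in> {\<sigma>1..\<sigma>2}" for x
    proof (rule analytic_at_imp_isCont, rule nicely_meromorphic_on_imp_analytic_at[OF f])
      show *: "Complex x T' \<in> strip a b"
        using that \<sigma> by (auto simp: strip_def)
      show "\<not> is_pole f (Complex x T')"
        using * \<open>\<forall>\<rho>\<in>poles f a b. \<bar>Im \<rho>\<bar> \<noteq> T\<close> \<open>\<bar>T'\<bar> = T\<close> by (force simp: poles_def)
    qed
    have "continuous_on {\<sigma>1..\<sigma>2} (\<lambda>x. f (Complex x T'))"
    proof (rule continuous_at_imp_continuous_on, rule ballI)
      fix x assume x: "x \<in> {\<sigma>1..\<sigma>2}"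
      have "isCont (\<lambda>x. Complex x T') x"
        unfolding Complex_eq by (intro continuous_intros)
      from continuous_within_compose3[OF ana[OF x] this] show "isCont (\<lambda>x. f (Complex x T')) x" .
    qed
    hence si: "set_integrable lborel {\<sigma>1..\<sigma>2} (\<lambda>x. f (Complex x T'))"
      by (rule borel_integrable_atLeastAtMost')
    have "norm (LBINT x:{\<sigma>1..\<sigma>2}. f (Complex x T')) \<le> (LBINT x:{\<sigma>1..\<sigma>2}. cmod (f (Complex x T')))"
      by (rule set_integral_norm_bound[OF si])
    thus ?thesis
      using set_borel_integral_eq_integral(2)[OF si] by simp
  qed
  have good: "eventually (\<lambda>T. T > 0 \<and> (\<forall>\<rho>\<in>poles f a b. \<bar>Im \<rho>\<bar> \<noteq> T)) ?F"
    using eventually_gt_at_top[of "0::real"] unfolding eventually_inf_principal by eventually_elim auto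
  have H1: "(?H \<longlongrightarrow> 0) ?F"
    by (rule Lim_null_comparison[OF _ up]) (use good in eventually_elim, auto intro!: bound)
  have H2: "((\<lambda>T. ?H (-T)) \<longlongrightarrow> 0) ?F"
    by (rule Lim_null_comparison[OF _ down]) (use good in eventually_elim, auto intro!: bound)
  have V: "((\<lambda>T. integral {-T..T} (\<lambda>t. f (Complex \<sigma>1 t))) \<longlongrightarrow> (\<integral>t. f (Complex \<sigma>1 t) \<partial>lborel)) ?F"
          "((\<lambda>T. integral {-T..T} (\<lambda>t. f (Complex \<sigma>2 t))) \<longlongrightarrow> (\<integral>t. f (Complex \<sigma>2 t) \<partial>lborel)) ?F"
    by (rule tendsto_mono[OF pole_free_heights_le_at_top tendsto_integral_symmetric_interval]; fact)+
  have "((\<lambda>T. ((\<i> * integral {-T..T} (\<lambda>t. f (Complex \<sigma>2 t)) - \<i> * integral {-T..T} (\<lambda>t. f (Complex \<sigma>1 t)))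
         + (?H (-T) - ?H T)) / (2 * of_real pi * \<i>)) \<longlongrightarrow>
         ((\<i> * (\<integral>t. f (Complex \<sigma>2 t) \<partial>lborel) - \<i> * (\<integral>t. f (Complex \<sigma>1 t) \<partial>lborel)) + (0 - 0)) / (2 * of_real pi * \<i>)) ?F"
    by (rule tendsto_divide tendsto_add tendsto_diff tendsto_mult tendsto_const V H1 H2)+ simp
  moreover have "eventually (\<lambda>T. ((\<i> * integral {-T..T} (\<lambda>t. f (Complex \<sigma>2 t)) - \<i> * integral {-T..T} (\<lambda>t. f (Complex \<sigma>1 t)))
         + (?H (-T) - ?H T)) / (2 * of_real pi * \<i>) = (\<Sum>\<rho>\<in>?P T. residue f \<rho>)) ?F"
    using good
  proof eventually_elim
    case (elim T)
    have "2 * of_real pi * \<i> * (\<Sum>\<rho>\<in>?P T. residue f \<rho>) =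
      (\<i> * integral {-T..T} (\<lambda>t. f (Complex \<sigma>2 t)) - \<i> * integral {-T..T} (\<lambda>t. f (Complex \<sigma>1 t)))
         + (?H (-T) - ?H T)"
      by (rule rectangle_residues[OF f \<sigma>]) (use elim lines in auto)
    thus ?case by (simp add: field_simps)
  qed
  ultimately have "((\<lambda>T. \<Sum>\<rho>\<in>?P T. residue f \<rho>) \<longlongrightarrow> (vline_integral f \<sigma>2 - vline_integral f \<sigma>1) / (2 * of_real pi * \<i>)) ?F"
    by (simp add: vline_integral_def tendsto_cong)
  thus ?thesis
    by (rule tendsto_pole_free_heights_imp_at_top[OF mero \<sigma>(1) \<sigma>(3)])
qed

lemma countable_remove_sings_neq:
  assumes "f meromorphic_on strip a b"
  shows "countable {z\<in>strip a b. remove_sings f z \<noteq> f z}"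
proof -
  have "{z. remove_sings f z \<noteq> f z} sparse_in strip a b"
    using eventually_remove_sings_eq[OF assms] by (simp add: eventually_cosparse)
  from sparse_imp_countable[OF open_strip this] show ?thesis
    by (rule countable_subset[rotated]) auto
qed

text \<open>A function satisfying \<open>meromorphic_on\<close> may have arbitrary values at isolated points.  Passing to
  \<open>remove_sings f\<close> alters it on a countable set only, so no line integral changes.\<close>

lemma vertical_shift:
  assumes f: "f meromorphic_on strip a b"
    and \<sigma>: "a < \<sigma>1" "\<sigma>1 < \<sigma>2" "\<sigma>2 < b"
    and lines: "\<forall>\<rho>\<in>poles f a b. Re \<rho> \<noteq> \<sigma>1 \<and> Re \<rho> \<noteq> \<sigma>2"
    and int: "integrable lborel (\<lambda>t. f (Complex \<sigma>1 t))" "integrable lborel (\<lambda>t. f (Complex \<sigma>2 t))"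
    and up: "((\<lambda>T. LBINT x:{\<sigma>1..\<sigma>2}. cmod (f (Complex x T))) \<longlongrightarrow> 0) (pole_free_heights f a b)"
    and down: "((\<lambda>T. LBINT x:{\<sigma>1..\<sigma>2}. cmod (f (Complex x (-T)))) \<longlongrightarrow> 0) (pole_free_heights f a b)"
  shows "((\<lambda>T. \<Sum>\<rho>\<in>{\<rho>\<in>poles f a b. \<sigma>1 < Re \<rho> \<and> Re \<rho> < \<sigma>2 \<and> \<bar>Im \<rho>\<bar> < T}. residue f \<rho>)
           \<longlongrightarrow> (vline_integral f \<sigma>2 - vline_integral f \<sigma>1) / (2 * of_real pi * \<i>)) at_top"
proof -
  define g where "g = remove_sings f"
  define D where "D = {z\<in>strip a b. g z \<noteq> f z}"
  have D: "countable D"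
    unfolding D_def g_def by (rule countable_remove_sings_neq[OF f])
  have iso: "isolated_singularity_at f z" if "z \<in> strip a b" for z
    by (rule meromorphic_on_isolated_singularity, rule meromorphic_on_subset[OF f]) (use that in auto)
  have poles: "poles g a b = poles f a b"
    using iso by (auto simp: poles_def g_def)
  have res: "residue g z = residue f z" if "z \<in> poles f a b" for z
    using that iso by (auto simp: poles_def g_def)
  have vert: "integrable lborel (\<lambda>t. g (Complex s t)) \<longleftrightarrow> integrable lborel (\<lambda>t. f (Complex s t))"
      "vline_integral g s = vline_integral f s" if "a < s" "s < b" for s
  proof -
    \<comment> \<open>A vertical line can meet \<open>D\<close> only at heights in the image of
      \<open>D\<close> under \<open>Im\<close>, which is countable and therefore null. Horizontal
      segments are treated in the same way with \<open>Re\<close>.\<close>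
    have X: "g (Complex s t) = f (Complex s t)" if "t \<notin> Im ` D" for t
    proof -
      have "Complex s t \<notin> D" using that by force
      thus ?thesis using \<open>a < s\<close> \<open>s < b\<close> by (simp add: D_def strip_def)
    qed
    show "integrable lborel (\<lambda>t. g (Complex s t)) \<longleftrightarrow> integrable lborel (\<lambda>t. f (Complex s t))"
      by (rule integrable_discrete_difference[of "Im ` D"]) (use X D in auto)
    show "vline_integral g s = vline_integral f s"
      unfolding vline_integral_def
      by (rule arg_cong[where f = "\<lambda>z. \<i> * z"], rule integral_discrete_difference[of "Im ` D"]) (use X D in auto)
  qed
  have hor: "(LBINT x:{\<sigma>1..\<sigma>2}. cmod (g (Complex x T))) = (LBINT x:{\<sigma>1..\<sigma>2}. cmod (f (Complex x T)))" for T
    unfolding set_lebesgue_integral_def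
  proof (rule integral_discrete_difference[of "Re ` D"])
    fix x assume "x \<notin> Re ` D"
    hence "Complex x T \<notin> D" by force
    thus "indicat_real {\<sigma>1..\<sigma>2} x *\<^sub>R cmod (g (Complex x T)) = indicat_real {\<sigma>1..\<sigma>2} x *\<^sub>R cmod (f (Complex x T))"
      using \<sigma> by (auto simp: D_def strip_def split: split_indicator)
  qed (use D in auto)
  have "((\<lambda>T. \<Sum>\<rho>\<in>{\<rho>\<in>poles g a b. \<sigma>1 < Re \<rho> \<and> Re \<rho> < \<sigma>2 \<and> \<bar>Im \<rho>\<bar> < T}. residue g \<rho>)
           \<longlongrightarrow> (vline_integral g \<sigma>2 - vline_integral g \<sigma>1) / (2 * of_real pi * \<i>)) at_top"
  proof (rule vertical_shift_nice)
    show "g nicely_meromorphic_on strip a b"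
      unfolding g_def by (rule remove_sings_nicely_meromorphic[OF f])
    show "integrable lborel (\<lambda>t. g (Complex \<sigma>1 t))" "integrable lborel (\<lambda>t. g (Complex \<sigma>2 t))"
      using int \<sigma> by (simp_all add: vert(1))
  qed (unfold poles hor, fact+)
  moreover have "vline_integral g \<sigma>1 = vline_integral f \<sigma>1" "vline_integral g \<sigma>2 = vline_integral f \<sigma>2"
    using \<sigma> by (simp_all add: vert(2))
  moreover have "(\<Sum>\<rho>\<in>{\<rho>\<in>poles f a b. Q \<rho>}. residue g \<rho>) = (\<Sum>\<rho>\<in>{\<rho>\<in>poles f a b. Q \<rho>}. residue f \<rho>)" for Q
    by (rule sum.cong) (simp_all add: res)
  ultimately show ?thesis
    unfolding poles by simp
qed

section \<open>Mellin inversion for the cosecant kernel\<close>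

text \<open>For -2 < Re s < 0 this is the Mellin transform of 1/(1+x^2) at -s.\<close>

definition csc_kernel :: "complex \<Rightarrow> complex" where
  "csc_kernel s = - (of_real pi / 2) / sin (of_real pi * s / 2)"

lemma Kfun_eq: "Kfun s = Gamma (s + 1) * csc_kernel s"
  by (simp add: Kfun_def csc_kernel_def)

text \<open>Both kernel bounds come from this splitting: far from the real axis the hyperbolic term
  alone is large, and on a vertical line the constant sine term prevents vanishing.\<close>

lemma norm_sin_squared': "(norm (sin z))\<^sup>2 = (sin (Re z))\<^sup>2 + (sinh (Im z))\<^sup>2"
proof -
  have "exp (2 * Im z) + inverse (exp (2 * Im z)) = 2 * cosh (2 * Im z)"
    by (simp add: cosh_field_def exp_minus)
  also have "\<dots> = 2 + 4 * (sinh (Im z))\<^sup>2"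
    by (simp add: cosh_double cosh_square_eq)
  finally show ?thesis
    by (simp add: norm_sin_squared cos_double_sin)
qed

lemma abs_le_abs_sinh: "\<bar>x\<bar> \<le> \<bar>sinh x\<bar>" for x :: real
  using real_le_abs_sinh[of x] by (simp add: sinh_field_def exp_minus)

text \<open>Quadratic growth is all that integrability of the kernel on a vertical line requires. It
  follows from the double-angle formula and the linear bound for sinh.\<close>

lemma one_plus_half_square_le_cosh: "1 + x\<^sup>2 / 2 \<le> cosh x" for x :: real
proof -
  have "cosh x = 1 + 2 * (sinh (x / 2))\<^sup>2"
    using cosh_double[of "x / 2"] by (simp add: cosh_square_eq)
  moreover have "(x / 2)\<^sup>2 \<le> (sinh (x / 2))\<^sup>2"
    using abs_le_abs_sinh[of "x / 2"] by (simp only: abs_le_square_iff)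
  ultimately show ?thesis by (simp add: power2_eq_square)
qed

text \<open>The linear bound for sinh at pi/2 times \<open>Im s\<close> cancels the factor pi/2 of
  the kernel. The estimate is uniform in \<open>Re s\<close>, as a whole horizontal segment
  demands.\<close>

lemma norm_csc_kernel_le_horizontal:
  assumes "Im s \<noteq> 0"
  shows "norm (csc_kernel s) \<le> 1 / \<bar>Im s\<bar>"
proof -
  let ?z = "of_real pi * s / 2"
  have "(pi / 2 * \<bar>Im s\<bar>)\<^sup>2 \<le> (sinh (Im ?z))\<^sup>2"
    using abs_le_abs_sinh[of "Im ?z"] unfolding abs_le_square_iff by (simp add: power_mult_distrib power_divide)
  also have "\<dots> \<le> (norm (sin ?z))\<^sup>2"
    by (simp add: norm_sin_squared')
  finally have "pi / 2 * \<bar>Im s\<bar> \<le> norm (sin ?z)"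
    by (rule power2_le_imp_le) simp
  moreover have "0 < pi / 2 * \<bar>Im s\<bar>"
    using assms by simp
  ultimately have "(pi / 2) / norm (sin ?z) \<le> (pi / 2) / (pi / 2 * \<bar>Im s\<bar>)"
    by (intro divide_left_mono mult_pos_pos) auto
  thus ?thesis
    by (simp add: csc_kernel_def norm_divide)
qed

text \<open>With k the sine in the bound, k^2 <= 1 gives k^2 + sinh^2 >= k^2 (1 + sinh^2) = k^2
  cosh^2. Then cosh(pi t/2) >= 1 + pi^2 t^2/8 >= 1 + t^2, because pi^2 > 8. The numerator 2 is pi/2
  rounded up.\<close>

lemma norm_csc_kernel_le_vertical:
  assumes "sin (pi * \<sigma> / 2) \<noteq> 0"
  shows "norm (csc_kernel (Complex \<sigma> t)) \<le> 2 / \<bar>sin (pi * \<sigma> / 2)\<bar> * inverse (1 + t\<^sup>2)"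
proof -
  let ?z = "of_real pi * Complex \<sigma> t / 2"
  let ?k = "sin (pi * \<sigma> / 2)"
  have "3 ^ 2 \<le> pi ^ 2"
    using pi_approx by (intro power_mono) auto
  hence "1 + t\<^sup>2 * 1 \<le> 1 + t\<^sup>2 * (pi ^ 2 / 8)"
    by (intro add_left_mono mult_left_mono) auto
  also have "\<dots> = 1 + (pi * t / 2)\<^sup>2 / 2"
    by (simp add: power2_eq_square)
  also have "\<dots> \<le> cosh (pi * t / 2)"
    by (rule one_plus_half_square_le_cosh)
  finally have t: "1 + t\<^sup>2 \<le> cosh (pi * t / 2)" by simp
  have "(\<bar>?k\<bar> * cosh (pi * t / 2))\<^sup>2 = ?k\<^sup>2 + ?k\<^sup>2 * (sinh (pi * t / 2))\<^sup>2"
    by (simp add: power_mult_distrib cosh_square_eq algebra_simps)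
  also have "\<dots> \<le> ?k\<^sup>2 + 1 * (sinh (pi * t / 2))\<^sup>2"
    by (intro add_left_mono mult_right_mono) (auto simp: abs_square_le_1)
  also have "\<dots> = (norm (sin ?z))\<^sup>2"
    by (simp add: norm_sin_squared')
  finally have "\<bar>?k\<bar> * cosh (pi * t / 2) \<le> norm (sin ?z)"
    by (rule power2_le_imp_le) simp
  moreover have "\<bar>?k\<bar> * (1 + t\<^sup>2) \<le> \<bar>?k\<bar> * cosh (pi * t / 2)"
    using t by (intro mult_left_mono) auto
  ultimately have le: "\<bar>?k\<bar> * (1 + t\<^sup>2) \<le> norm (sin ?z)" by simp
  have pos: "0 < \<bar>?k\<bar> * (1 + t\<^sup>2)"
    using assms by (intro mult_pos_pos) (auto simp: add_pos_nonneg)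
  have "norm (csc_kernel (Complex \<sigma> t)) = (pi / 2) / norm (sin ?z)"
    by (simp add: csc_kernel_def norm_divide)
  also have "\<dots> \<le> 2 / (\<bar>?k\<bar> * (1 + t\<^sup>2))"
    using le pos pi_less_4 by (intro frac_le) auto
  finally show ?thesis
    by (simp add: field_simps)
qed

section \<open>Integrability of the cosecant kernel on vertical lines\<close>

lemma sin_half_pi_neq_0:
  assumes "-2 < Re s" "Re s < 2" "s \<noteq> 0"
  shows "sin (of_real pi * s / 2) \<noteq> 0"
proof
  assume "sin (of_real pi * s / 2) = 0"
  then obtain n :: int where "of_real pi * s / 2 = of_real (of_int n * pi)"
    by (auto simp: sin_eq_0)
  hence s: "s = of_int (2 * n)"
    by (simp add: field_simps)
  with assms have "n = 0"
    by (simp add: s)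
  with s assms show False by simp
qed

lemma sin_half_pi_neq_0_real: "-2 < x \<Longrightarrow> x < 2 \<Longrightarrow> x \<noteq> 0 \<Longrightarrow> sin (pi * x / 2) \<noteq> 0"
  using sin_half_pi_neq_0[of "of_real x"]
  by (metis Re_complex_of_real of_real_0 of_real_divide of_real_mult of_real_numeral sin_of_real)

lemma integrable_inverse_1_plus_square: "integrable lborel (\<lambda>t::real. inverse (1 + t\<^sup>2))"
proof -
  let ?f = "\<lambda>t::real. inverse (1 + t\<^sup>2)"
  have nn: "(\<integral>\<^sup>+x. ennreal (?f x) * indicator {0..} x \<partial>lborel) = ennreal (pi / 2 - arctan 0)"
  proof (rule nn_integral_FTC_atLeast)
    show "DERIV arctan x :> ?f x" if "0 \<le> x" for x
      by (rule DERIV_arctan)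
    show "(arctan \<longlongrightarrow> pi / 2) at_top"
      by (rule tendsto_arctan_at_top)
  qed (auto simp: add_nonneg_nonneg)
  have 1: "integrable lborel (\<lambda>x. indicator {0..} x * ?f x)"
  proof (rule integrableI_nonneg)
    have "(\<integral>\<^sup>+x. ennreal (indicator {0..} x * ?f x) \<partial>lborel) = (\<integral>\<^sup>+x. ennreal (?f x) * indicator {0..} x \<partial>lborel)"
      by (rule nn_integral_cong) (auto split: split_indicator)
    thus "(\<integral>\<^sup>+x. ennreal (indicator {0..} x * ?f x) \<partial>lborel) < \<infinity>"
      by (simp add: nn)
  qed auto
  \<comment> \<open>Reflection in 0 supplies the negative half-line. The sum counts the point 0
    twice, which is harmless for a dominating function.\<close>
  have 2: "integrable lborel (\<lambda>x. indicator {0..} (0 + (-1) * x) * ?f (0 + (-1) * x))"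
    by (rule lborel_integrable_real_affine[OF 1]) simp
  have "integrable lborel (\<lambda>x. indicator {0..} x * ?f x + indicator {0..} (0 + (-1) * x) * ?f (0 + (-1) * x))"
    by (rule Bochner_Integration.integrable_add[OF 1 2])
  thus ?thesis
    by (rule Bochner_Integration.integrable_bound) (auto split: split_indicator)
qed

lemma continuous_on_Complex: "continuous_on A (Complex \<sigma>)" "continuous_on A (\<lambda>x. Complex x T)"
  unfolding Complex_eq by (intro continuous_intros)+

lemma continuous_csc_kernel_line:
  assumes "-2 < \<sigma>" "\<sigma> < 2" "\<sigma> \<noteq> 0"
  shows "continuous_on UNIV (\<lambda>t. csc_kernel (Complex \<sigma> t))"
  unfolding csc_kernel_def
proof (intro continuous_intros continuous_on_Complex ballI)
  fix t show "sin (complex_of_real pi * Complex \<sigma> t / 2) \<noteq> 0"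
    by (rule sin_half_pi_neq_0) (use assms in \<open>auto simp: complex_eq_iff\<close>)
qed auto

lemma integrable_csc_kernel_line:
  assumes "-2 < \<sigma>" "\<sigma> < 2" "\<sigma> \<noteq> 0"
  shows "integrable lborel (\<lambda>t. csc_kernel (Complex \<sigma> t))"
proof (rule Bochner_Integration.integrable_bound)
  show "integrable lborel (\<lambda>t. 2 / \<bar>sin (pi * \<sigma> / 2)\<bar> * inverse (1 + t\<^sup>2))"
    by (intro integrable_mult_right integrable_inverse_1_plus_square)
  show "(\<lambda>t. csc_kernel (Complex \<sigma> t)) \<in> borel_measurable lborel"
    using continuous_csc_kernel_line[OF assms] by (simp add: borel_measurable_continuous_onI)
  show "AE t in lborel. norm (csc_kernel (Complex \<sigma> t)) \<le> norm (2 / \<bar>sin (pi * \<sigma> / 2)\<bar> * inverse (1 + t\<^sup>2))"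
  proof
    fix t
    show "norm (csc_kernel (Complex \<sigma> t)) \<le> norm (2 / \<bar>sin (pi * \<sigma> / 2)\<bar> * inverse (1 + t\<^sup>2))"
      using norm_csc_kernel_le_vertical[OF sin_half_pi_neq_0_real[OF assms], of t]
      by (rule order_trans) simp
  qed
qed

lemma norm_of_real_powr: "x > 0 \<Longrightarrow> norm (of_real x powr s :: complex) = x powr Re s" for x :: real
  by (simp add: norm_powr_real_powr)

text \<open>The integrand satisfies \<open>F (s + 2) = - x\<^sup>2 * F s\<close>, so shifting the line by two units across the
  single pole at 0, where the residue is -1, determines the integral.\<close>

lemma csc_kernel_inversion:
  assumes x: "x > (0::real)" and c: "-2 < c" "c < 0"
  shows "integral\<^sup>L lborel (\<lambda>t. csc_kernel (Complex c t) * of_real x powr (Complex c t)) =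
           of_real (2 * pi / (1 + x\<^sup>2))"
proof -
  define F where "F = (\<lambda>s. csc_kernel s * of_real x powr s)"
  define g where "g = (\<lambda>s. sin (of_real pi * s / 2) :: complex)"
  define h where "h = (\<lambda>s. - (of_real pi / 2) * of_real x powr s :: complex)"
  have F_eq: "F = (\<lambda>s. h s / g s)"
    by (auto simp: F_def h_def g_def csc_kernel_def)
  have h: "h holomorphic_on A" and g: "g holomorphic_on A" for A
    using x unfolding h_def g_def by (auto intro!: holomorphic_intros)
  have h_ana: "h analytic_on A" and g_ana: "g analytic_on A" for A
    by (rule analytic_on_subset[OF _ subset_UNIV], simp add: analytic_on_open h g)+
  \<comment> \<open>This strip contains both lines, at \<open>c\<close> and at \<open>c + 2\<close>,
    and 0 is the only even integer, hence the only zero of \<open>g\<close>, inside it.\<close>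
  have g0: "g s \<noteq> 0" if "s \<in> strip (-2) 2" "s \<noteq> 0" for s
    unfolding g_def using that by (intro sin_half_pi_neq_0) (auto simp: strip_def)
  have mero: "F meromorphic_on strip (-2) 2"
    unfolding F_eq by (intro meromorphic_intros analytic_on_imp_meromorphic_on h_ana g_ana)
  have F_ana: "F analytic_on {s}" if "s \<in> strip (-2) 2" "s \<noteq> 0" for s
    unfolding F_eq using g0[OF that] by (intro analytic_intros h_ana g_ana) auto
  have pole0: "is_pole F 0"
    unfolding F_eq
  proof (rule is_pole_divide)
    show "isCont h 0"
      by (rule analytic_at_imp_isCont[OF h_ana])
    show "h 0 \<noteq> 0"
      using x by (simp add: h_def)
    have "eventually (\<lambda>s. s \<in> strip (-2) 2 - {0}) (at 0)"
      by (rule eventually_at_in_open) (auto simp: open_strip, auto simp: strip_def)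
    hence "eventually (\<lambda>s. g s \<noteq> 0) (at 0)"
      by eventually_elim (use g0 in auto)
    moreover have "g \<midarrow>0\<rightarrow> g 0"
      using analytic_at_imp_isCont[OF g_ana, of 0] by (simp add: isCont_def)
    ultimately show "filterlim g (at 0) (at 0)"
      by (simp add: filterlim_at g_def)
  qed
  have poles: "poles F (-2) 2 = {0}"
    using pole0 F_ana by (auto simp: poles_def strip_def dest: analytic_at_imp_no_pole)
  \<comment> \<open>At a simple pole the residue is h(0)/g'(0), here -(pi/2) divided by
    pi/2.\<close>
  have res: "residue F 0 = -1"
  proof -
    have "(g has_field_derivative (of_real pi / 2)) (at 0)"
      unfolding g_def by (auto intro!: derivative_eq_intros)
    hence "residue (\<lambda>s. h s / g s) 0 = h 0 / (of_real pi / 2)"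
      by (intro residue_simple_pole_deriv[of _ UNIV] h g) (use x in \<open>auto simp: h_def g_def\<close>)
    thus ?thesis
      using x by (simp add: F_eq h_def)
  qed
  have int: "integrable lborel (\<lambda>t. F (Complex \<sigma> t))" if \<sigma>: "-2 < \<sigma>" "\<sigma> < 2" "\<sigma> \<noteq> 0" for \<sigma>
  proof (rule Bochner_Integration.integrable_bound)
    show "integrable lborel (\<lambda>t. csc_kernel (Complex \<sigma> t) * of_real (x powr \<sigma>))"
      by (intro integrable_mult_left integrable_csc_kernel_line \<sigma>)
    have "continuous_on UNIV (\<lambda>t. F (Complex \<sigma> t))"
      unfolding F_def using x
      by (intro continuous_intros continuous_csc_kernel_line[OF \<sigma>] continuous_on_Complex) auto
    thus "(\<lambda>t. F (Complex \<sigma> t)) \<in> borel_measurable lborel"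
      by (simp add: borel_measurable_continuous_onI)
  qed (use x in \<open>simp add: F_def norm_mult norm_of_real_powr\<close>)
  \<comment> \<open>The sign \<open>sg\<close> treats the upper and the lower side together. Since
    the norm of x^s depends on \<open>Re s\<close> only, the side is at most 1/T times a
    constant.\<close>
  have hor: "((\<lambda>T. LBINT \<sigma>:{c..c+2}. cmod (F (Complex \<sigma> (sg * T)))) \<longlongrightarrow> 0) at_top" if sg: "\<bar>sg\<bar> = 1" for sg
  proof (rule Lim_null_comparison)
    let ?B = "LBINT \<sigma>:{c..c+2}. x powr \<sigma>"
    show "((\<lambda>T. (1 / T) * ?B) \<longlongrightarrow> 0) at_top"
      by (intro tendsto_mult_left_zero tendsto_divide_0[OF tendsto_const] filterlim_at_top_imp_at_infinity filterlim_ident)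
    show "eventually (\<lambda>T. norm (LBINT \<sigma>:{c..c+2}. cmod (F (Complex \<sigma> (sg * T)))) \<le> (1 / T) * ?B) at_top"
      using eventually_gt_at_top[of 0]
    proof eventually_elim
      case (elim T)
      have "(LBINT \<sigma>:{c..c+2}. cmod (F (Complex \<sigma> (sg * T)))) \<le> (LBINT \<sigma>:{c..c+2}. (1 / T) * x powr \<sigma>)"
        unfolding set_lebesgue_integral_def
      proof (rule integral_mono')
        have "set_integrable lborel {c..c+2} (\<lambda>\<sigma>. (1 / T) * x powr \<sigma>)"
          using x by (intro borel_integrable_atLeastAtMost' continuous_intros) auto
        thus "integrable lborel (\<lambda>\<sigma>. indicat_real {c..c+2} \<sigma> *\<^sub>R ((1 / T) * x powr \<sigma>))"
          by (simp add: set_integrable_def)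
        fix \<sigma>
        have "norm (csc_kernel (Complex \<sigma> (sg * T))) \<le> 1 / T"
          using norm_csc_kernel_le_horizontal[of "Complex \<sigma> (sg * T)"] elim sg by (auto simp: abs_mult)
        hence "cmod (F (Complex \<sigma> (sg * T))) \<le> (1 / T) * x powr \<sigma>"
          unfolding F_def using x by (simp only: norm_mult norm_of_real_powr complex.sel) (rule mult_right_mono, auto)
        thus "indicat_real {c..c+2} \<sigma> *\<^sub>R cmod (F (Complex \<sigma> (sg * T))) \<le> indicat_real {c..c+2} \<sigma> *\<^sub>R ((1 / T) * x powr \<sigma>)"
          by (intro scaleR_left_mono) auto
        show "0 \<le> indicat_real {c..c+2} \<sigma> *\<^sub>R ((1 / T) * x powr \<sigma>)"
          using elim by simp
      qed
      also have "\<dots> = (1 / T) * ?B"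
        by (rule set_integral_mult_right)
      finally have "(LBINT \<sigma>:{c..c+2}. cmod (F (Complex \<sigma> (sg * T)))) \<le> (1 / T) * ?B" .
      moreover have "(LBINT \<sigma>:{c..c+2}. cmod (F (Complex \<sigma> (sg * T)))) \<ge> 0"
        unfolding set_lebesgue_integral_def by (intro integral_nonneg_AE) auto
      ultimately show ?case by simp
    qed
  qed
  have "((\<lambda>T. \<Sum>\<rho>\<in>{\<rho>\<in>poles F (-2) 2. c < Re \<rho> \<and> Re \<rho> < c + 2 \<and> \<bar>Im \<rho>\<bar> < T}. residue F \<rho>)
           \<longlongrightarrow> (vline_integral F (c + 2) - vline_integral F c) / (2 * of_real pi * \<i>)) at_top"
  proof (rule vertical_shift[OF mero])
    show "((\<lambda>T. LBINT x:{c..c + 2}. cmod (F (Complex x T))) \<longlongrightarrow> 0) (pole_free_heights F (-2) 2)"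
      using hor[of 1] by (intro tendsto_mono[OF pole_free_heights_le_at_top]) auto
    show "((\<lambda>T. LBINT x:{c..c + 2}. cmod (F (Complex x (-T)))) \<longlongrightarrow> 0) (pole_free_heights F (-2) 2)"
      using hor[of "-1"] by (intro tendsto_mono[OF pole_free_heights_le_at_top]) auto
    show "integrable lborel (\<lambda>t. F (Complex c t))" "integrable lborel (\<lambda>t. F (Complex (c + 2) t))"
      by (rule int; use c in simp)+
    show "\<forall>\<rho>\<in>poles F (-2) 2. Re \<rho> \<noteq> c \<and> Re \<rho> \<noteq> c + 2"
      using c by (simp add: poles)
  qed (use c in simp_all)
  moreover have "eventually (\<lambda>T. (\<Sum>\<rho>\<in>{\<rho>\<in>poles F (-2) 2. c < Re \<rho> \<and> Re \<rho> < c + 2 \<and> \<bar>Im \<rho>\<bar> < T}. residue F \<rho>) = -1) at_top"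
    using eventually_gt_at_top[of 0]
  proof eventually_elim
    case (elim T)
    have "{\<rho>\<in>poles F (-2) 2. c < Re \<rho> \<and> Re \<rho> < c + 2 \<and> \<bar>Im \<rho>\<bar> < T} = {0}"
      using c elim by (auto simp: poles)
    thus ?case by (simp add: res)
  qed
  ultimately have "((\<lambda>T::real. -1) \<longlongrightarrow> (vline_integral F (c + 2) - vline_integral F c) / (2 * of_real pi * \<i>)) at_top"
    by (rule Lim_transform_eventually)
  \<comment> \<open>Writing V for the integral over the line at \<open>c\<close>, the relation
    V(c+2) = -x^2 V proved next turns this into (1 + x^2) V = 2 pi i.\<close>
  hence "(vline_integral F (c + 2) - vline_integral F c) / (2 * of_real pi * \<i>) = -1"
    by (simp add: tendsto_const_iff)
  moreover have "vline_integral F (c + 2) = - of_real (x\<^sup>2) * vline_integral F c"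
  proof -
    have "F (Complex (c + 2) t) = - of_real (x\<^sup>2) * F (Complex c t)" for t
    proof -
      have C: "Complex (c + 2) t = Complex c t + 2"
        by (simp add: complex_eq_iff)
      have "sin (of_real pi * (Complex c t + 2) / 2) = - sin (of_real pi * Complex c t / 2)"
        by (simp add: sin_add sin_of_real cos_of_real distrib_left add_divide_distrib)
      moreover have "of_real x powr (Complex c t + 2) = of_real (x\<^sup>2) * of_real x powr (Complex c t)"
        using x by (simp add: powr_add)
      ultimately show ?thesis
        by (simp add: F_def C csc_kernel_def)
    qed
    thus ?thesis by (simp add: vline_integral_def)
  qed
  ultimately have "\<i> * ((1 + of_real (x\<^sup>2)) * integral\<^sup>L lborel (\<lambda>t. F (Complex c t))) = \<i> * (2 * of_real pi)"
    by (simp add: vline_integral_def field_simps)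
  hence "(1 + of_real (x\<^sup>2)) * integral\<^sup>L lborel (\<lambda>t. F (Complex c t)) = 2 * of_real pi"
    unfolding mult_cancel_left by simp
  moreover have "1 + of_real (x\<^sup>2) \<noteq> (0 :: complex)"
    by (metis add_pos_nonneg of_real_1 of_real_add of_real_eq_0_iff order_less_irrefl zero_le_power2 zero_less_one)
  ultimately show ?thesis
    by (simp add: F_def field_simps)
qed

section \<open>The integral over the line of absolute convergence\<close>

text \<open>\<open>Phi\<close> is only Lebesgue measurable, so Fubini has to be applied with the
  completed measure \<open>lebesgue\<close> in the variable y.\<close>

lemma sigma_finite_completion:
  assumes "sigma_finite_measure M"
  shows "sigma_finite_measure (completion M)"
proof
  from sigma_finite_measure.sigma_finite_countable[OF assms]
  obtain A where "countable A" "A \<subseteq> sets M" "\<Union>A = space M" "\<forall>a\<in>A. emeasure M a \<noteq> \<infinity>"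
    by blast
  moreover from this have "emeasure (completion M) a = emeasure M a" if "a \<in> A" for a
    using that by (subst emeasure_completion) auto
  ultimately show "\<exists>A. countable A \<and> A \<subseteq> sets (completion M) \<and> \<Union>A = space (completion M) \<and>
      (\<forall>a\<in>A. emeasure (completion M) a \<noteq> \<infinity>)"
    by (intro exI[of _ A]) (auto simp: subset_eq)
qed

lemma measurable_cis [measurable]: "cis \<in> borel_measurable borel"
  by (intro borel_measurable_continuous_onI continuous_intros)

lemma integrable_mult_cis:
  fixes g :: "'a \<Rightarrow> complex"
  assumes "integrable M g" "\<phi> \<in> borel_measurable M"
  shows "integrable M (\<lambda>x. g x * cis (\<phi> x))"
proof (rule Bochner_Integration.integrable_bound[OF assms(1)])
  have [measurable]: "g \<in> borel_measurable M" "\<phi> \<in> borel_measurable M"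
    using assms by auto
  show "(\<lambda>x. g x * cis (\<phi> x)) \<in> borel_measurable M"
    by measurable
qed (simp add: norm_mult)

text \<open>All dependence on both variables sits in a phase of modulus 1, so the product of the
  norms of \<open>g\<close> and \<open>h\<close> dominates and joint integrability is immediate. The
  measure stays general because both \<open>lborel\<close> and \<open>lebesgue\<close>
  occur.\<close>

lemma Fubini_cis:
  fixes g :: "'a \<Rightarrow> complex" and h :: "real \<Rightarrow> complex"
  assumes M: "sigma_finite_measure M" and g: "integrable M g" and h: "integrable lborel h"
    and \<phi> [measurable]: "\<phi> \<in> borel_measurable M"
  shows "(\<integral>x. g x * (\<integral>t. h t * cis (t * \<phi> x) \<partial>lborel) \<partial>M) =
         (\<integral>t. h t * (\<integral>x. g x * cis (t * \<phi> x) \<partial>M) \<partial>lborel)"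
proof -
  interpret M: sigma_finite_measure M by fact
  interpret P: pair_sigma_finite M lborel ..
  have [measurable]: "g \<in> borel_measurable M" "h \<in> borel_measurable borel"
    using g borel_measurable_integrable[OF h] by auto
  have inner: "integrable lborel (\<lambda>t. g x * h t * cis (t * \<phi> x))" for x
    by (intro integrable_mult_cis integrable_mult_right h) auto
  have "integrable (M \<Otimes>\<^sub>M lborel) (\<lambda>(x, t). g x * h t * cis (t * \<phi> x))"
  proof (rule P.Fubini_integrable)
    show "(\<lambda>(x, t). g x * h t * cis (t * \<phi> x)) \<in> borel_measurable (M \<Otimes>\<^sub>M lborel)"
      by measurable
    have "integrable M (\<lambda>x. norm (g x) * (\<integral>t. norm (h t) \<partial>lborel))"
      using g by simp
    thus "integrable M (\<lambda>x. \<integral>t. norm (case (x, t) of (x, t) \<Rightarrow> g x * h t * cis (t * \<phi> x)) \<partial>lborel)"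
      by (simp add: norm_mult)
  qed (use inner in simp)
  from P.Fubini_integral[OF this]
  have "(\<integral>t. (\<integral>x. g x * h t * cis (t * \<phi> x) \<partial>M) \<partial>lborel) = (\<integral>x. (\<integral>t. g x * h t * cis (t * \<phi> x) \<partial>lborel) \<partial>M)"
    by simp
  moreover have "(\<integral>x. g x * h t * cis (t * \<phi> x) \<partial>M) = h t * (\<integral>x. g x * cis (t * \<phi> x) \<partial>M)" for t
    by (subst integral_mult_right_zero[symmetric]) (simp add: mult_ac)
  moreover have "(\<integral>t. g x * h t * cis (t * \<phi> x) \<partial>lborel) = g x * (\<integral>t. h t * cis (t * \<phi> x) \<partial>lborel)" for x
    by (subst integral_mult_right_zero[symmetric]) (simp add: mult_ac)
  ultimately show ?thesis by simp
qed

section \<open>Powers as modulus times phase, and Euler's integral on a vertical line\<close>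

lemma of_real_powr_Complex:
  assumes "x > 0"
  shows "of_real x powr Complex c t = of_real (x powr c) * cis (t * ln x)"
proof -
  have "of_real x powr Complex c t = exp (Complex c t * of_real (ln x))"
    using assms by (simp add: powr_def Ln_of_real)
  also have "Complex c t * of_real (ln x) = of_real (c * ln x) + \<i> * of_real (t * ln x)"
    by (simp add: Complex_eq algebra_simps)
  also have "exp \<dots> = of_real (exp (c * ln x)) * cis (t * ln x)"
    by (simp only: exp_add exp_of_real cis_conv_exp)
  also have "exp (c * ln x) = x powr c"
    using assms by (simp add: powr_def)
  finally show ?thesis .
qed

lemma
  assumes c: "c > -1" and z: "z > 0"
  shows integrable_Gamma_integrand: "integrable lborel (\<lambda>u. of_real (indicator {0<..} u * u powr c * exp (- (z * u))) :: complex)" (is "integrable lborel ?g")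
    and Gamma_line_integral: "(\<integral>u. of_real (indicator {0<..} u * u powr c * exp (- (z * u))) * cis (t * ln u) \<partial>lborel)
           = Gamma (Complex c t + 1) * of_real z powr (- Complex c t - 1)"
proof -
  have int: "integrable lborel (\<lambda>u. of_real (indicator {0<..} u * u powr c * exp (- (z * u))) :: complex)" if "z > 0" for z
  proof -
    have "set_integrable lebesgue {0<..} (\<lambda>u. complex_of_real u powr (of_real (c + 1) - 1) / of_real (exp (z * u)))"
      by (rule absolutely_integrable_Gamma_integral) (use c that in auto)
    hence "integrable lebesgue (\<lambda>u. indicator {0<..} u *\<^sub>R (complex_of_real u powr (of_real (c + 1) - 1) / of_real (exp (z * u))))"
      by (simp add: set_integrable_def)
    also have "(\<lambda>u. indicator {0<..} u *\<^sub>R (complex_of_real u powr (of_real (c + 1) - 1) / of_real (exp (z * u)))) =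
        (\<lambda>u. of_real (indicator {0<..} u * u powr c * exp (- (z * u))))"
      by (auto simp: fun_eq_iff powr_of_real exp_minus field_simps split: split_indicator)
    finally show ?thesis
      by (subst (asm) integrable_completion) auto
  qed
  show "integrable lborel ?g"
    by (rule int[OF z])
  define G where "G = (\<lambda>u. of_real (indicator {0<..} u * u powr c * exp (- u)) * cis (t * ln u) :: complex)"
  have "((\<lambda>u. of_real u powr (Complex c t + 1 - 1) / of_real (exp u)) has_integral Gamma (Complex c t + 1)) {0<..}"
    by (rule Gamma_integral_complex') (use c in simp)
  moreover have "set_integrable lebesgue {0<..} (\<lambda>u. complex_of_real u powr (Complex c t + 1 - 1) / of_real (exp u))"
    by (rule absolutely_integrable_Gamma_integral') (use c in simp)
  ultimately have "(LINT u:{0<..}|lebesgue. complex_of_real u powr (Complex c t + 1 - 1) / of_real (exp u)) = Gamma (Complex c t + 1)"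
    by (simp add: set_lebesgue_integral_eq_integral(2) integral_unique)
  moreover have "(LINT u:{0<..}|lebesgue. complex_of_real u powr (Complex c t + 1 - 1) / of_real (exp u)) = integral\<^sup>L lebesgue G"
    unfolding set_lebesgue_integral_def G_def
    by (rule Bochner_Integration.integral_cong)
       (auto simp: of_real_powr_Complex exp_minus field_simps split: split_indicator)
  moreover have "integral\<^sup>L lebesgue G = integral\<^sup>L lborel G"
    by (rule integral_completion) (simp add: G_def)
  ultimately have "Gamma (Complex c t + 1) = integral\<^sup>L lborel G" by simp
  \<comment> \<open>Substituting z u for u: the Jacobian z and the power z^s together give z^(s+1),
    which is then moved to the other side.\<close>
  also have "\<dots> = z *\<^sub>R (\<integral>u. G (0 + z * u) \<partial>lborel)"
    using lborel_integral_real_affine[of z G 0] z by simp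
  also have "(\<lambda>u. G (0 + z * u)) = (\<lambda>u. of_real z powr Complex c t * (?g u * cis (t * ln u)))"
    using z by (auto simp: G_def fun_eq_iff of_real_powr_Complex powr_mult ln_mult ring_distribs cis_mult
        zero_less_mult_iff split: split_indicator)
  also have "z *\<^sub>R (\<integral>u. of_real z powr Complex c t * (?g u * cis (t * ln u)) \<partial>lborel) =
      of_real z powr (Complex c t + 1) * (\<integral>u. ?g u * cis (t * ln u) \<partial>lborel)"
    using z by (simp add: powr_add scaleR_conv_of_real)
  finally have "Gamma (Complex c t + 1) * of_real z powr (- (Complex c t + 1)) =
      (of_real z powr (Complex c t + 1) * of_real z powr (- (Complex c t + 1))) * (\<integral>u. ?g u * cis (t * ln u) \<partial>lborel)"
    by (simp add: mult_ac)
  also have "of_real z powr (Complex c t + 1) * of_real z powr (- (Complex c t + 1)) = 1"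
    using z by (simp flip: powr_add)
  finally show "(\<integral>u. ?g u * cis (t * ln u) \<partial>lborel) = Gamma (Complex c t + 1) * of_real z powr (- Complex c t - 1)"
    by simp
qed

text \<open>Taking norms inside Euler's integral removes the phase and with it the dependence on
  \<open>t\<close>. Decay along the line is left to the cosecant factor.\<close>

lemma norm_Gamma_line_le:
  assumes "c > -1"
  obtains B where "\<And>t. norm (Gamma (Complex c t + 1)) \<le> B"
proof
  fix t
  let ?g = "\<lambda>u::real. of_real (indicator {0<..} u * u powr c * exp (- (1 * u))) :: complex"
  have "Gamma (Complex c t + 1) = (\<integral>u. ?g u * cis (t * ln u) \<partial>lborel)"
    using Gamma_line_integral[of c 1 t] assms by simp
  also have "norm \<dots> \<le> (\<integral>u. norm (?g u * cis (t * ln u)) \<partial>lborel)"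
    by (rule integral_norm_bound)
  finally show "norm (Gamma (Complex c t + 1)) \<le> (\<integral>u. norm (?g u) \<partial>lborel)"
    by (simp add: norm_mult)
qed

text \<open>Integrability feeds the Fubini exchange for \<open>Sfun\<close>; boundedness serves to
  exclude poles of \<open>Ic\<close> on the line Re s = c.\<close>

lemma
  assumes c: "-1 < c" "c < 0"
  shows integrable_Kfun_line: "integrable lborel (\<lambda>t. Kfun (Complex c t))"
    and bounded_Kfun_line: "\<exists>B. \<forall>t. norm (Kfun (Complex c t)) \<le> B"
proof -
  obtain B where B: "\<And>t. norm (Gamma (Complex c t + 1)) \<le> B"
    using norm_Gamma_line_le c by blast
  have B0: "B \<ge> 0"
    using B[of 0] norm_ge_zero order_trans by blast
  show "integrable lborel (\<lambda>t. Kfun (Complex c t))"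
  proof (rule Bochner_Integration.integrable_bound)
    show "integrable lborel (\<lambda>t. B * norm (csc_kernel (Complex c t)))"
      by (intro integrable_mult_right integrable_norm integrable_csc_kernel_line) (use c in auto)
    have "continuous_on UNIV (\<lambda>t. Gamma (Complex c t + 1))"
    proof (rule continuous_on_compose2[of "{z. Re z > 0}" Gamma])
      show "continuous_on {z. Re z > 0} (Gamma :: complex \<Rightarrow> complex)"
        by (intro continuous_on_Gamma) (auto elim!: nonpos_Ints_cases)
      show "continuous_on UNIV (\<lambda>t. Complex c t + 1)"
        by (intro continuous_intros continuous_on_Complex)
    qed (use c in auto)
    hence "continuous_on UNIV (\<lambda>t. Kfun (Complex c t))"
      unfolding Kfun_eq using c by (intro continuous_intros continuous_csc_kernel_line) auto
    thus "(\<lambda>t. Kfun (Complex c t)) \<in> borel_measurable lborel"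
      by (simp add: borel_measurable_continuous_onI)
    show "AE t in lborel. norm (Kfun (Complex c t)) \<le> norm (B * norm (csc_kernel (Complex c t)))"
      using B B0 by (auto simp: Kfun_eq norm_mult intro!: mult_right_mono)
  qed
  have "norm (Kfun (Complex c t)) \<le> B * (2 / \<bar>sin (pi * c / 2)\<bar> * 1)" for t
  proof -
    have "norm (csc_kernel (Complex c t)) \<le> 2 / \<bar>sin (pi * c / 2)\<bar> * inverse (1 + t\<^sup>2)"
      by (rule norm_csc_kernel_le_vertical, rule sin_half_pi_neq_0_real) (use c in auto)
    also have "\<dots> \<le> 2 / \<bar>sin (pi * c / 2)\<bar> * 1"
      by (rule mult_left_mono) (auto simp: field_simps add_pos_nonneg)
    finally show ?thesis
      unfolding Kfun_eq norm_mult by (rule mult_mono[OF B _ B0]) simp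
  qed
  thus "\<exists>B. \<forall>t. norm (Kfun (Complex c t)) \<le> B" by blast
qed

text \<open>Write the Gamma factor of the kernel as an integral over \<open>u\<close>, exchange the integrals and evaluate
  the inner one with the cosecant kernel; the factor \<open>1 / (1 + u\<^sup>2)\<close> of \<open>Xi\<close> appears.\<close>

lemma Xi_inversion:
  assumes c: "-1 < c" "c < 0" and z: "z > 0"
  shows "(\<integral>t. Kfun (Complex c t) * of_real z powr (- Complex c t) \<partial>lborel) = of_real (2 * pi * Xi z)"
proof -
  define g where "g = (\<lambda>u::real. of_real (indicator {0<..} u * u powr c * exp (- (z * u))) :: complex)"
  define h where "h = (\<lambda>t. csc_kernel (Complex c t))"
  have "(\<integral>t. Kfun (Complex c t) * of_real z powr (- Complex c t) \<partial>lborel) =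
        (\<integral>t. of_real z * (h t * (\<integral>u. g u * cis (t * ln u) \<partial>lborel)) \<partial>lborel)"
  proof (rule Bochner_Integration.integral_cong)
    fix t
    \<comment> \<open>The factor z split off here becomes the factor in front of the integral in
      \<open>Xi\<close>.\<close>
    have "of_real z powr (- Complex c t) = of_real z * of_real z powr (- Complex c t - 1)"
      using z by (simp add: powr_diff)
    thus "Kfun (Complex c t) * of_real z powr (- Complex c t) =
        of_real z * (h t * (\<integral>u. g u * cis (t * ln u) \<partial>lborel))"
      using Gamma_line_integral[OF c(1) z, of t] by (simp add: Kfun_eq g_def h_def)
  qed simp
  also have "\<dots> = of_real z * (\<integral>t. h t * (\<integral>u. g u * cis (t * ln u) \<partial>lborel) \<partial>lborel)"
    by simp
  also have "(\<integral>t. h t * (\<integral>u. g u * cis (t * ln u) \<partial>lborel) \<partial>lborel) =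
      (\<integral>u. g u * (\<integral>t. h t * cis (t * ln u) \<partial>lborel) \<partial>lborel)"
    unfolding g_def h_def using c z
    by (intro Fubini_cis[symmetric] integrable_Gamma_integrand integrable_csc_kernel_line sigma_finite_lborel) auto
  also have "\<dots> = (\<integral>u. of_real (2 * pi * (indicator {0<..} u *\<^sub>R (exp (- z * u) / (1 + u\<^sup>2)))) \<partial>lborel)"
  proof (rule Bochner_Integration.integral_cong)
    fix u :: real
    show "g u * (\<integral>t. h t * cis (t * ln u) \<partial>lborel) = of_real (2 * pi * (indicator {0<..} u *\<^sub>R (exp (- z * u) / (1 + u\<^sup>2))))"
    proof (cases "u > 0")
      case True
      \<comment> \<open>The modulus u^c contained in \<open>g\<close> rejoins the phase to form the
        power u^s of the inversion formula. For nonpositive u both sides vanish through the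
        indicator.\<close>
      have "of_real (u powr c) * (\<integral>t. h t * cis (t * ln u) \<partial>lborel) = (\<integral>t. of_real (u powr c) * (h t * cis (t * ln u)) \<partial>lborel)"
        by simp
      also have "\<dots> = (\<integral>t. csc_kernel (Complex c t) * of_real u powr Complex c t \<partial>lborel)"
        using True by (intro Bochner_Integration.integral_cong) (auto simp: h_def of_real_powr_Complex)
      also have "\<dots> = of_real (2 * pi / (1 + u\<^sup>2))"
        by (rule csc_kernel_inversion) (use True c in auto)
      finally have "of_real (exp (- (z * u))) * (of_real (u powr c) * (\<integral>t. h t * cis (t * ln u) \<partial>lborel)) =
          of_real (exp (- (z * u))) * (of_real (2 * pi / (1 + u\<^sup>2)) :: complex)"
        by (rule arg_cong)
      thus ?thesis
        using True by (simp add: g_def mult_ac)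
    qed (simp add: g_def)
  qed simp
  also have "of_real z * \<dots> = of_real (2 * pi * Xi z)"
    unfolding Xi_def set_lebesgue_integral_def
    by (simp only: integral_complex_of_real integral_mult_right_zero) (simp add: mult_ac)
  finally show ?thesis .
qed

text \<open>On the line Re s = c the Mellin integrand is the fixed integrable function
  \<open>g\<close> times a phase. Hence absolute convergence holds at every height, with a bound
  independent of \<open>t\<close>.\<close>

lemma
  fixes Phi :: "real \<Rightarrow> complex"
  assumes meas: "set_borel_measurable lebesgue {0<..} Phi"
    and abs_c: "set_integrable lebesgue {0<..} (\<lambda>y. cmod (Phi y) * y powr (- c - 1))"
  defines "g \<equiv> \<lambda>y. indicator {0<..} y *\<^sub>R Phi y * of_real (y powr (- c - 1))"
  shows integrable_mellin_weight: "integrable lebesgue g"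
    and mellin_abs_conv_line: "mellin_abs_conv Phi (- Complex c t)"
    and mellinF_line: "mellinF Phi (- Complex c t) = (\<integral>y. g y * cis (t * - ln y) \<partial>lebesgue)"
    and norm_mellinF_line_le: "norm (mellinF Phi (- Complex c t)) \<le> (\<integral>y. norm (g y) \<partial>lebesgue)"
proof -
  have [measurable]: "(\<lambda>y. indicator {0<..} y *\<^sub>R Phi y) \<in> borel_measurable lebesgue"
    using meas by (simp add: set_borel_measurable_def)
  have [measurable]: "(\<lambda>y::real. complex_of_real (y powr (- c - 1))) \<in> borel_measurable lebesgue"
    by (rule measurable_completion) simp
  have [measurable]: "(\<lambda>y::real. t * - ln y) \<in> borel_measurable lebesgue" for t
    by (rule measurable_completion) simp
  have [measurable]: "g \<in> borel_measurable lebesgue"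
    unfolding g_def by measurable
  show int: "integrable lebesgue g"
  proof (rule Bochner_Integration.integrable_bound)
    show "integrable lebesgue (\<lambda>y. indicator {0<..} y *\<^sub>R (cmod (Phi y) * y powr (- c - 1)))"
      using abs_c by (simp add: set_integrable_def)
    show "AE y in lebesgue. norm (g y) \<le> norm (indicator {0<..} y *\<^sub>R (cmod (Phi y) * y powr (- c - 1)))"
      by (auto simp: g_def norm_mult)
  qed simp
  have eq: "indicator {0<..} y *\<^sub>R (of_real y powr (- Complex c t - 1) * Phi y) = g y * cis (t * - ln y)" for y t
  proof (cases "y > 0")
    case True
    have "- Complex c t - 1 = Complex (- c - 1) (- t)"
      by (simp add: complex_eq_iff)
    with True show ?thesis
      by (simp add: of_real_powr_Complex g_def)
  qed (simp add: g_def)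
  show "mellin_abs_conv Phi (- Complex c t)"
    unfolding mellin_abs_conv_def set_integrable_def eq by (intro integrable_mult_cis int) measurable
  show F: "mellinF Phi (- Complex c t) = (\<integral>y. g y * cis (t * - ln y) \<partial>lebesgue)"
    unfolding mellinF_def set_lebesgue_integral_def eq ..
  have "norm (mellinF Phi (- Complex c t)) \<le> (\<integral>y. norm (g y * cis (t * - ln y)) \<partial>lebesgue)"
    unfolding F by (rule integral_norm_bound)
  thus "norm (mellinF Phi (- Complex c t)) \<le> (\<integral>y. norm (g y) \<partial>lebesgue)"
    by (simp add: norm_mult)
qed

text \<open>After the exchange the inner integral over t is \<open>Xi_inversion\<close> at z = mu
  y.\<close>

lemma Sfun_eq_vline_integral:
  fixes Phi :: "real \<Rightarrow> complex"
  assumes meas: "set_borel_measurable lebesgue {0<..} Phi"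
    and c: "-1 < c" "c < 0"
    and abs_c: "set_integrable lebesgue {0<..} (\<lambda>y. cmod (Phi y) * y powr (- c - 1))"
    and mu: "0 < \<mu>"
  shows "Sfun Phi \<mu> = vline_integral (Ifun Phi \<mu>) c / (2 * of_real pi * \<i>)"
proof -
  define g where "g y = indicator {0<..} y *\<^sub>R Phi y * of_real (y powr (- c - 1))" for y
  define h where "h = (\<lambda>t. Kfun (Complex c t) * of_real \<mu> powr (- Complex c t))"
  note mellin = mellinF_line[OF meas abs_c, folded g_def]
  have int_g: "integrable lebesgue g"
    by (rule integrable_mellin_weight[OF meas abs_c, folded g_def])
  have neg: "- Complex c t = Complex (- c) (- t)" for t
    by (simp add: complex_eq_iff)
  have int_h: "integrable lborel h"
  proof -
    have "integrable lborel (\<lambda>t. (of_real (\<mu> powr (- c)) * Kfun (Complex c t)) * cis (- t * ln \<mu>))"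
      by (intro integrable_mult_cis integrable_mult_right integrable_Kfun_line c) auto
    also have "(\<lambda>t. (of_real (\<mu> powr (- c)) * Kfun (Complex c t)) * cis (- t * ln \<mu>)) = h"
      using mu by (simp add: h_def fun_eq_iff neg of_real_powr_Complex)
    finally show ?thesis .
  qed
  have "(\<integral>t. h t * mellinF Phi (- Complex c t) \<partial>lborel) = (\<integral>t. h t * (\<integral>y. g y * cis (t * - ln y) \<partial>lebesgue) \<partial>lborel)"
    unfolding mellin ..
  also have "\<dots> = (\<integral>y. g y * (\<integral>t. h t * cis (t * - ln y) \<partial>lborel) \<partial>lebesgue)"
    by (intro Fubini_cis[symmetric] int_g int_h sigma_finite_completion sigma_finite_lborel measurable_completion) auto
  also have "\<dots> = (\<integral>y. 2 * of_real pi * (indicator {0<..} y *\<^sub>R (Phi y / of_real y * of_real (Xi (\<mu> * y)))) \<partial>lebesgue)"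
  proof (rule Bochner_Integration.integral_cong)
    fix y :: real
    show "g y * (\<integral>t. h t * cis (t * - ln y) \<partial>lborel) = 2 * of_real pi * (indicator {0<..} y *\<^sub>R (Phi y / of_real y * of_real (Xi (\<mu> * y))))"
    proof (cases "y > 0")
      case True
      \<comment> \<open>The weight y^(-c-1) in \<open>g\<close> splits into 1/y, which belongs to
        the integrand of \<open>Sfun\<close>, and y^(-c), which joins the phase and mu^(-s) to form
        (mu y)^(-s).\<close>
      have "of_real (y powr (- c)) * (\<integral>t. h t * cis (t * - ln y) \<partial>lborel) = (\<integral>t. of_real (y powr (- c)) * (h t * cis (t * - ln y)) \<partial>lborel)"
        by simp
      also have "\<dots> = (\<integral>t. Kfun (Complex c t) * of_real (\<mu> * y) powr (- Complex c t) \<partial>lborel)"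
        unfolding h_def neg using True mu
        by (intro Bochner_Integration.integral_cong)
           (simp_all only: of_real_powr_Complex mult_pos_pos, simp_all add: powr_mult ln_mult ring_distribs, simp add: cis_mult)
      also have "\<dots> = of_real (2 * pi * Xi (\<mu> * y))"
        by (rule Xi_inversion) (use c mu True in auto)
      finally have eq: "of_real (y powr (- c)) * (\<integral>t. h t * cis (t * - ln y) \<partial>lborel) = of_real (2 * pi * Xi (\<mu> * y))" .
      have "g y = Phi y / of_real y * of_real (y powr (- c))"
        using True by (simp add: g_def powr_diff)
      hence "g y * (\<integral>t. h t * cis (t * - ln y) \<partial>lborel) = Phi y / of_real y * of_real (2 * pi * Xi (\<mu> * y))"
        using eq by (simp add: mult.assoc)
      thus ?thesis
        using True by simp
    qed (simp add: g_def)
  qed simp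
  also have "\<dots> = 2 * of_real pi * (LINT y:{0<..}|lebesgue. Phi y / of_real y * of_real (Xi (\<mu> * y)))"
    unfolding set_lebesgue_integral_def by (rule integral_mult_right_zero)
  finally have eq: "(\<integral>t. h t * mellinF Phi (- Complex c t) \<partial>lborel) =
      2 * of_real pi * (LINT y:{0<..}|lebesgue. Phi y / of_real y * of_real (Xi (\<mu> * y)))" .
  have "vline_integral (Ifun Phi \<mu>) c = \<i> * (\<integral>t. 1 / D0 Phi * (h t * mellinF Phi (- Complex c t)) \<partial>lborel)"
    unfolding vline_integral_def Ifun_def h_def by (simp add: mult_ac)
  also have "\<dots> = 2 * of_real pi * \<i> * Sfun Phi \<mu>"
    by (simp only: integral_mult_right_zero eq) (simp add: Sfun_def mult_ac)
  finally show ?thesis by simp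
qed

section \<open>Residues and the expansions\<close>

lemma residue_sum:
  assumes "open S" "z \<in> S" "\<And>j. j \<in> A \<Longrightarrow> F j holomorphic_on S - {z}"
  shows "residue (\<lambda>s. \<Sum>j\<in>A. F j s) z = (\<Sum>j\<in>A. residue (F j) z)"
  using assms(3)
proof (induction A rule: infinite_finite_induct)
  case (insert j A)
  thus ?case
    by (simp add: residue_add[OF assms(1,2)] holomorphic_on_sum)
qed (simp_all add: residue_const)

text \<open>Meromorphy rules out an essential singularity and boundedness a pole, so the singularity
  is removable.\<close>

lemma residue_eq_0_if_bounded:
  assumes f: "f meromorphic_on {z}" and O: "f \<in> O[at z](\<lambda>_. 1)"
  shows "residue f z = 0"
proof -
  have iso: "isolated_singularity_at f z" and "not_essential f z"
    using f by (simp_all add: meromorphic_at_iff)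
  obtain C where C: "C > 0" "eventually (\<lambda>s. norm (f s) \<le> C) (at z)"
    using O by (elim landau_o.bigE) auto
  have "\<not> is_pole f z"
  proof
    assume "is_pole f z"
    hence "eventually (\<lambda>s. norm (f s) \<ge> C + 1) (at z)"
      using C(1) by (auto simp: is_pole_def filterlim_at_infinity[of 0])
    with C(2) have "eventually (\<lambda>s. False) (at z)"
      by eventually_elim auto
    thus False by simp
  qed
  with \<open>not_essential f z\<close> obtain c where "f \<midarrow>z\<rightarrow> c"
    by (auto simp: not_essential_def)
  from remove_sings_analytic_at[OF iso this]
  obtain S where "open S" "z \<in> S" "remove_sings f holomorphic_on S"
    by (auto simp: analytic_at)
  from residue_holo[OF this] show ?thesis
    using iso by simp
qed

text \<open>The bounded remainder times \<open>g\<close> has residue 0, and the term of order j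
  picks out the Taylor coefficient of \<open>g\<close> of order j - 1.\<close>

lemma residue_mult_principal_part:
  assumes f: "f meromorphic_on {z}" and g: "g analytic_on {z}"
    and O: "(\<lambda>s. f s - (\<Sum>j=1..m. coef j / (s - z) ^ j)) \<in> O[at z](\<lambda>_. 1)"
  shows "residue (\<lambda>s. g s * f s) z = (\<Sum>j=1..m. coef j * (deriv ^^ (j - 1)) g z / fact (j - 1))"
proof -
  define h where "h = (\<lambda>s. f s - (\<Sum>j=1..m. coef j / (s - z) ^ j))"
  obtain r1 where r1: "r1 > 0" "g holomorphic_on ball z r1"
    using g by (auto simp: analytic_at_ball)
  obtain r2 where r2: "r2 > 0" "f analytic_on ball z r2 - {z}"
    using f unfolding meromorphic_at_iff isolated_singularity_at_def by auto
  define S where "S = ball z (min r1 r2)"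
  have S: "open S" "z \<in> S"
    using r1 r2 by (auto simp: S_def)
  have g_S: "g holomorphic_on S"
    by (rule holomorphic_on_subset[OF r1(2)]) (auto simp: S_def)
  hence g_S': "g holomorphic_on S - {z}"
    by (rule holomorphic_on_subset) auto
  have f_S: "f holomorphic_on S - {z}"
    by (rule holomorphic_on_subset[OF analytic_imp_holomorphic[OF r2(2)]]) (auto simp: S_def)
  have h_S: "h holomorphic_on S - {z}"
    unfolding h_def by (intro holomorphic_intros f_S) auto
  have p_S: "(\<lambda>s. g s * (coef j / (s - z) ^ j)) holomorphic_on S - {z}" for j
    by (intro holomorphic_intros g_S') auto
  have "h meromorphic_on {z}"
    unfolding h_def by (intro meromorphic_intros f)
  hence gh: "(\<lambda>s. g s * h s) meromorphic_on {z}"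
    by (rule meromorphic_on_mult[OF analytic_on_imp_meromorphic_on[OF g]])
  have "g \<in> O[at z](\<lambda>_. 1)"
    by (rule continuous_imp_bigo_1[OF analytic_at_imp_isCont[OF g]])
  from landau_o.big_mult[OF this O[folded h_def]]
  have "residue (\<lambda>s. g s * h s) z = 0"
    by (intro residue_eq_0_if_bounded gh) simp
  moreover have "(\<lambda>s. g s * f s) = (\<lambda>s. g s * h s + (\<Sum>j=1..m. g s * (coef j / (s - z) ^ j)))"
    by (simp add: h_def fun_eq_iff ring_distribs sum_distrib_left)
  moreover have "residue (\<lambda>s. g s * (coef j / (s - z) ^ j)) z = coef j * (deriv ^^ (j - 1)) g z / fact (j - 1)"
    if "j \<in> {1..m}" for j
  proof -
    have "residue (\<lambda>s. g s * (coef j / (s - z) ^ j)) z = residue (\<lambda>s. coef j * (g s / (s - z) ^ Suc (j - 1))) z"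
      using that by (intro arg_cong[where f = "\<lambda>f. residue f z"]) (auto simp: fun_eq_iff)
    also have "\<dots> = coef j * residue (\<lambda>s. g s / (s - z) ^ Suc (j - 1)) z"
      by (rule residue_lmul[OF S]) (auto intro!: holomorphic_intros g_S')
    also have "residue (\<lambda>s. g s / (s - z) ^ Suc (j - 1)) z = (deriv ^^ (j - 1)) g z / fact (j - 1)"
      by (rule residue_holomorphic_over_power[OF S g_S])
    finally show ?thesis by simp
  qed
  ultimately show ?thesis
    using residue_add[OF S, of "\<lambda>s. g s * h s" "\<lambda>s. \<Sum>j=1..m. g s * (coef j / (s - z) ^ j)"]
      residue_sum[OF S, of "{1..m}" "\<lambda>j s. g s * (coef j / (s - z) ^ j)"] p_S
    by (simp add: g_S' h_S holomorphic_on_mult holomorphic_on_sum)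
qed

lemma higher_deriv_powr_minus:
  assumes "x > (0::real)"
  shows "(deriv ^^ k) (\<lambda>s. C * of_real x powr (- s)) = (\<lambda>s. C * (- of_real (ln x)) ^ k * of_real x powr (- s) :: complex)"
proof (induction k)
  case (Suc k)
  have powr_eq: "of_real x powr (- s) = exp (- s * complex_of_real (ln x))" for s
    using assms by (simp add: powr_def Ln_of_real)
  have "deriv (\<lambda>s. C * (- of_real (ln x)) ^ k * of_real x powr (- s) :: complex) s =
      C * (- of_real (ln x)) ^ Suc k * of_real x powr (- s)" for s
    unfolding powr_eq by (intro DERIV_imp_deriv) (auto intro!: derivative_eq_intros)
  thus ?case
    unfolding funpow.simps o_apply Suc by (rule ext)
qed simp

text \<open>At a pole the norm tends to infinity from every direction, in particular along the line;
  a bound on the line alone is therefore a contradiction.\<close>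

lemma not_pole_if_bounded_on_line:
  assumes "\<And>t. norm (f (Complex c t)) \<le> C" "Re z = c"
  shows "\<not> is_pole f z"
proof
  assume "is_pole f z"
  hence *: "filterlim f at_infinity (at z)"
    by (simp add: is_pole_def)
  have "((\<lambda>t. Complex c t) \<longlongrightarrow> Complex c (Im z)) (at (Im z))"
    unfolding Complex_eq by (intro tendsto_intros)
  moreover have "Complex c (Im z) = z"
    using assms(2) by (simp add: complex_eq_iff)
  moreover have "eventually (\<lambda>t. Complex c t \<noteq> z) (at (Im z))"
    unfolding eventually_at_filter by (intro always_eventually) auto
  ultimately have "filterlim (\<lambda>t. Complex c t) (at z) (at (Im z))"
    by (simp add: filterlim_at)
  from filterlim_compose[OF * this]
  \<comment> \<open>The maximum with 1 makes the radius positive, as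
    \<open>filterlim_at_infinity\<close> demands, whatever the sign of \<open>C\<close>.\<close>
  have "eventually (\<lambda>t. norm (f (Complex c t)) \<ge> max 1 (C + 1)) (at (Im z))"
    unfolding filterlim_at_infinity[OF order_refl]
    by (elim allE[of _ "max 1 (C + 1)"] impE) auto
  hence "eventually (\<lambda>t. False) (at (Im z))"
    by eventually_elim (use assms(1) in \<open>smt (verit)\<close>)
  thus False by simp
qed

theorem theorem2:
  fixes Phi :: "real \<Rightarrow> complex" and c a b \<mu> :: real and Ic :: "complex \<Rightarrow> complex"
  assumes meas: "set_borel_measurable lebesgue {0<..} Phi"
    and c: "-1 < c" "c < 0"
    and D0_fin: "set_integrable lebesgue {0<..} (\<lambda>y. Phi y / of_real y)"
    and D0_nz: "D0 Phi \<noteq> 0"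
    and abs_c: "set_integrable lebesgue {0<..} (\<lambda>y. cmod (Phi y) * y powr (- c - 1))"
    and mu: "0 < \<mu>"
    and abc: "a < c" "c < b"
    and mero: "Ic meromorphic_on strip a b"
    and cont: "\<forall>s \<in> strip a b. mellin_abs_conv Phi (- s) \<longrightarrow> Ic s = Ifun Phi \<mu> s"
    and A_fin: "\<forall>\<sigma>. a < \<sigma> \<and> \<sigma> < b \<and> (\<forall>\<rho> \<in> poles Ic a b. Re \<rho> \<noteq> \<sigma>) \<longrightarrow>
        integrable lborel (\<lambda>t. Ic (Complex \<sigma> t) * (of_real \<mu> :: complex) powr (Complex \<sigma> t))"
    and horiz: "\<forall>\<sigma>1 \<sigma>2. a < \<sigma>1 \<and> \<sigma>1 < \<sigma>2 \<and> \<sigma>2 < b \<longrightarrow>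
        filterlim (\<lambda>T. LBINT \<sigma>:{\<sigma>1..\<sigma>2}. cmod (Ic (Complex \<sigma> T))) (nhds 0)
          (inf at_top (principal {T. \<forall>\<rho> \<in> poles Ic a b. \<bar>Im \<rho>\<bar> \<noteq> T})) \<and>
        filterlim (\<lambda>T. LBINT \<sigma>:{\<sigma>1..\<sigma>2}. cmod (Ic (Complex \<sigma> (- T)))) (nhds 0)
          (inf at_top (principal {T. \<forall>\<rho> \<in> poles Ic a b. \<bar>Im \<rho>\<bar> \<noteq> T}))"
  shows "(\<forall>\<sigma>m \<sigma>p. a < \<sigma>m \<and> \<sigma>m < c \<and> c < \<sigma>p \<and> \<sigma>p < b \<and>
            (\<forall>\<rho> \<in> poles Ic a b. Re \<rho> \<noteq> \<sigma>m \<and> Re \<rho> \<noteq> \<sigma>p) \<longrightarrow>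
          ((\<lambda>T. \<Sum>\<rho> \<in> {\<rho> \<in> poles Ic a b. \<sigma>m < Re \<rho> \<and> Re \<rho> < c \<and> \<bar>Im \<rho>\<bar> < T}. residue Ic \<rho>)
              \<longlongrightarrow> Sfun Phi \<mu> - vline_integral Ic \<sigma>m / (2 * of_real pi * \<i>)) at_top \<and>
          ((\<lambda>T. - (\<Sum>\<rho> \<in> {\<rho> \<in> poles Ic a b. c < Re \<rho> \<and> Re \<rho> < \<sigma>p \<and> \<bar>Im \<rho>\<bar> < T}. residue Ic \<rho>))
              \<longlongrightarrow> Sfun Phi \<mu> - vline_integral Ic \<sigma>p / (2 * of_real pi * \<i>)) at_top)
   \<and> (\<forall>\<sigma>. a < \<sigma> \<and> \<sigma> < b \<and> (\<forall>\<rho> \<in> poles Ic a b. Re \<rho> \<noteq> \<sigma>) \<longrightarrow>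
          cmod (vline_integral Ic \<sigma> / (2 * of_real pi * \<i>)) \<le> \<mu> powr (- \<sigma>) / (2 * pi) * Afun Ic \<mu> \<sigma>)
   \<and> (\<forall>\<rho> m (coef :: nat \<Rightarrow> complex). \<rho> \<in> poles Ic a b \<and> m \<ge> 1 \<and> coef m \<noteq> 0 \<and>
          (\<lambda>s. D0 Phi * Ic s * (of_real \<mu> :: complex) powr s
               - (\<Sum>j=1..m. coef j / (s - \<rho>) ^ j)) \<in> O[at \<rho>](\<lambda>_. 1) \<longrightarrow>
          residue Ic \<rho> = (of_real \<mu> :: complex) powr (- \<rho>) *
             ((1 / D0 Phi) * (\<Sum>j=1..m. coef j * (- of_real (ln \<mu>)) ^ (j - 1) / of_nat (fact (j - 1)))))"
proof (intro conjI allI impI, goal_cases)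
  have Ic_line: "Ic (Complex c t) = Ifun Phi \<mu> (Complex c t)" for t
    using cont mellin_abs_conv_line[OF meas abs_c, of t] abc by (simp add: strip_def)
  have pole_free_c: "\<forall>\<rho>\<in>poles Ic a b. Re \<rho> \<noteq> c"
  proof -
    define M where "M = (\<integral>y. norm (indicator {0<..} y *\<^sub>R Phi y * complex_of_real (y powr (- c - 1))) \<partial>lebesgue)"
    obtain B where B: "\<And>t. norm (Kfun (Complex c t)) \<le> B"
      using bounded_Kfun_line[OF c] by blast
    have "B \<ge> 0"
      using B[of 0] norm_ge_zero order_trans by blast
    have "norm (Ic (Complex c t)) \<le> norm (1 / D0 Phi) * B * M * \<mu> powr (- c)" for t
    proof -
      have "norm (mellinF Phi (- Complex c t)) \<le> M"
        unfolding M_def by (rule norm_mellinF_line_le[OF meas abs_c])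
      hence "norm (1 / D0 Phi) * norm (Kfun (Complex c t)) * norm (mellinF Phi (- Complex c t)) * \<mu> powr (- c)
          \<le> norm (1 / D0 Phi) * B * M * \<mu> powr (- c)"
        using B \<open>B \<ge> 0\<close> by (intro mult_right_mono mult_mono mult_left_mono) auto
      thus ?thesis
        using mu by (simp only: Ic_line Ifun_def norm_mult norm_of_real_powr uminus_complex.sel complex.sel)
    qed
    from not_pole_if_bounded_on_line[of Ic c, OF this] show ?thesis
      by (auto simp: poles_def)
  qed
  have S_eq: "Sfun Phi \<mu> = vline_integral Ic c / (2 * of_real pi * \<i>)"
    using Sfun_eq_vline_integral[OF meas c abs_c mu] by (simp add: vline_integral_def Ic_line)
  \<comment> \<open>The hypothesis \<open>A_fin\<close> concerns \<open>Ic\<close> times mu^s.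
    Multiplying by the constant modulus and the phase of mu^(-s) restores \<open>Ic\<close> and
    preserves integrability.\<close>
  have int: "integrable lborel (\<lambda>t. Ic (Complex \<sigma> t))"
    if "a < \<sigma>" "\<sigma> < b" "\<forall>\<rho>\<in>poles Ic a b. Re \<rho> \<noteq> \<sigma>" for \<sigma>
  proof -
    have "integrable lborel (\<lambda>t. of_real (\<mu> powr (- \<sigma>)) * (Ic (Complex \<sigma> t) * of_real \<mu> powr (Complex \<sigma> t)) * cis (- t * ln \<mu>))"
      using A_fin that by (intro integrable_mult_cis integrable_mult_right) auto
    also have "(\<lambda>t. of_real (\<mu> powr (- \<sigma>)) * (Ic (Complex \<sigma> t) * of_real \<mu> powr (Complex \<sigma> t)) * cis (- t * ln \<mu>)) = (\<lambda>t. Ic (Complex \<sigma> t))"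
    proof
      fix t
      have "Complex (- \<sigma>) (- t) = - Complex \<sigma> t"
        by (simp add: complex_eq_iff)
      hence "of_real \<mu> powr Complex (- \<sigma>) (- t) * of_real \<mu> powr Complex \<sigma> t = (1 :: complex)"
        using mu by (simp flip: powr_add)
      thus "of_real (\<mu> powr (- \<sigma>)) * (Ic (Complex \<sigma> t) * of_real \<mu> powr (Complex \<sigma> t)) * cis (- t * ln \<mu>) = Ic (Complex \<sigma> t)"
        using mu by (simp add: of_real_powr_Complex mult_ac)
    qed
    finally show ?thesis .
  qed
  have shift: "((\<lambda>T. \<Sum>\<rho>\<in>{\<rho>\<in>poles Ic a b. \<sigma>1 < Re \<rho> \<and> Re \<rho> < \<sigma>2 \<and> \<bar>Im \<rho>\<bar> < T}. residue Ic \<rho>)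
           \<longlongrightarrow> (vline_integral Ic \<sigma>2 - vline_integral Ic \<sigma>1) / (2 * of_real pi * \<i>)) at_top"
    if \<sigma>: "a < \<sigma>1" "\<sigma>1 < \<sigma>2" "\<sigma>2 < b"
      and lines: "\<forall>\<rho>\<in>poles Ic a b. Re \<rho> \<noteq> \<sigma>1" "\<forall>\<rho>\<in>poles Ic a b. Re \<rho> \<noteq> \<sigma>2" for \<sigma>1 \<sigma>2
  proof (rule vertical_shift[OF mero \<sigma>])
    show "\<forall>\<rho>\<in>poles Ic a b. Re \<rho> \<noteq> \<sigma>1 \<and> Re \<rho> \<noteq> \<sigma>2"
      using lines by blast
    show "integrable lborel (\<lambda>t. Ic (Complex \<sigma>1 t))"
      by (rule int[OF _ _ lines(1)]) (use \<sigma> in linarith)+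
    show "integrable lborel (\<lambda>t. Ic (Complex \<sigma>2 t))"
      by (rule int[OF _ _ lines(2)]) (use \<sigma> in linarith)+
  qed (use horiz \<sigma> in blast)+
  {
    case (1 \<sigma>m \<sigma>p)
    hence "a < \<sigma>m" "\<sigma>m < c" "\<forall>\<rho>\<in>poles Ic a b. Re \<rho> \<noteq> \<sigma>m" by blast+
    from shift[OF this(1,2) abc(2) this(3) pole_free_c] show ?case
      unfolding S_eq diff_divide_distrib .
  next
    case (2 \<sigma>m \<sigma>p)
    hence "c < \<sigma>p" "\<sigma>p < b" "\<forall>\<rho>\<in>poles Ic a b. Re \<rho> \<noteq> \<sigma>p" by blast+
    \<comment> \<open>Here \<open>c\<close> is the left line, so the shift yields the integral at
      \<open>\<sigma>p\<close> minus the one at \<open>c\<close>; negation puts \<open>Sfun\<close>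
      in front.\<close>
    from tendsto_minus[OF shift[OF abc(1) this(1,2) pole_free_c this(3)]] show ?case
      unfolding S_eq diff_divide_distrib minus_diff_eq .
  next
    case (3 \<sigma>)
    let ?J = "\<integral>t. cmod (Ic (Complex \<sigma> t)) \<partial>lborel"
    \<comment> \<open>The norm of mu^s is constant on the line, so it leaves the integral and
      cancels against the factor in the bound.\<close>
    have "Afun Ic \<mu> \<sigma> = \<mu> powr \<sigma> * ?J"
      using mu by (simp add: Afun_def norm_mult norm_of_real_powr mult.commute)
    moreover have "\<mu> powr (- \<sigma>) * \<mu> powr \<sigma> = 1"
      using mu by (simp flip: powr_add)
    ultimately have A: "\<mu> powr (- \<sigma>) * Afun Ic \<mu> \<sigma> = ?J"
      by (simp only: mult.assoc[symmetric] mult_1)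
    have "cmod (vline_integral Ic \<sigma> / (2 * of_real pi * \<i>)) = cmod (\<integral>t. Ic (Complex \<sigma> t) \<partial>lborel) / (2 * pi)"
      by (simp add: vline_integral_def norm_mult norm_divide)
    also have "\<dots> \<le> ?J / (2 * pi)"
      by (intro divide_right_mono integral_norm_bound) simp
    also have "\<dots> = \<mu> powr (- \<sigma>) / (2 * pi) * Afun Ic \<mu> \<sigma>"
      unfolding A[symmetric] by simp
    finally show ?case .
  next
    case (4 \<rho> m coef)
    \<comment> \<open>\<open>f\<close> continues K(s) F(-s), whose principal part is given, and
      \<open>g\<close> is the entire factor mu^(-s)/D0, whose derivatives produce the powers of - ln
      mu.\<close>
    define g where "g = (\<lambda>s. 1 / D0 Phi * of_real \<mu> powr (- s) :: complex)"
    define f where "f = (\<lambda>s. D0 Phi * Ic s * of_real \<mu> powr s)"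
    have ana: "(\<lambda>s. of_real \<mu> powr s :: complex) analytic_on A" "(\<lambda>s. of_real \<mu> powr (- s) :: complex) analytic_on A" for A
      by (rule analytic_on_subset[OF _ subset_UNIV], unfold analytic_on_open[OF open_UNIV],
          use mu in \<open>auto intro!: holomorphic_intros\<close>)+
    have \<rho>: "Ic meromorphic_on {\<rho>}"
      by (rule meromorphic_on_subset[OF mero]) (use 4 in \<open>auto simp: poles_def\<close>)
    have "Ic = (\<lambda>s. g s * f s)"
    proof
      fix s
      have "of_real \<mu> powr (- s) * of_real \<mu> powr s = (1 :: complex)"
        using mu by (simp flip: powr_add)
      thus "Ic s = g s * f s"
        using D0_nz by (simp add: g_def f_def mult_ac)
    qed
    hence "residue Ic \<rho> = residue (\<lambda>s. g s * f s) \<rho>"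
      by (rule arg_cong)
    also have "\<dots> = (\<Sum>j=1..m. coef j * (deriv ^^ (j - 1)) g \<rho> / fact (j - 1))"
    proof (rule residue_mult_principal_part)
      show "f meromorphic_on {\<rho>}"
        unfolding f_def by (intro meromorphic_intros \<rho> analytic_on_imp_meromorphic_on[OF ana(1)])
      show "g analytic_on {\<rho>}"
        unfolding g_def by (intro analytic_intros ana)
      show "(\<lambda>s. f s - (\<Sum>j = 1..m. coef j / (s - \<rho>) ^ j)) \<in> O[at \<rho>](\<lambda>_. 1)"
        using 4 by (simp add: f_def)
    qed
    finally have "residue Ic \<rho> = (\<Sum>j=1..m. coef j * (deriv ^^ (j - 1)) g \<rho> / fact (j - 1))" .
    moreover have "(deriv ^^ k) g \<rho> = 1 / D0 Phi * (- of_real (ln \<mu>)) ^ k * of_real \<mu> powr (- \<rho>)" for k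
      unfolding g_def higher_deriv_powr_minus[OF mu] ..
    ultimately show ?case
      by (simp add: sum_distrib_left mult_ac)
  }
qed

end
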